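(* Let $\sigma_1$ be the 2-cocycle on the Lie algebra $\mathbb{C}[z,z^{-1}][\frac{\partial}{\partial z}]$ obtained by transporting, via the isomorphism $g$, the Calkin cocycle $\sigma_0$ of $\mathbb{C}[x]\langle\partial,\partial^{-1}\rangle$, i.e. $\sigma_1(A,B)=\sigma_0(g(A),g(B))$. Let $\tau$ be the Kac cocycle on $\mathbb{C}[z,z^{-1}][\frac{\partial}{\partial z}]$. Then $\sigma_1=\tau$.
   Context: Regard $\mathbb{C}[x]$ as a differential ring with derivation $a\mapsto a'=\frac{\partial a}{\partial x}$. $\mathbb{C}[x]\langle\partial,\partial^{-1}\rangle$ is the ring generated by $\mathbb{C}[x]$, $\partial$ and $\partial^{-1}$ inside the field of quotients of the Ore domain $\mathbb{C}(x)\langle\partial\rangle$ of differential operators (where $\partial a-a\partial=a'$). Each of its elements can be written as $\sum_{i=0}^{n}a_i\partial^i+\sum_{j=1}^{m}b_j\partial^{-1}c_j$ with $a_i,b_j,c_j\in\mathbb{C}[x]$. Define the linear map $\alpha_0:\mathbb{C}[x]\langle\partial,\partial^{-1}\rangle\to \mathrm{End}_{\mathbb{C}}(\mathbb{C}[x])$ by $$\alpha_0\Bigl(\sum_{i=0}^{n}a_i\partial^i+\sum_{j=1}^{m}b_j\partial^{-1}c_j\Bigr)=\sum_{i=0}^{n}a_iD^i+\sum_{j=1}^{m}b_jLc_j,$$ where $D=\frac{\partial}{\partial x}$, $L(x^k)=\frac{x^{k+1}}{k+1}$ for $k\ge0$, and polynomials act by multiplication. Modulo the ideal of finite-rank maps,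 $\alpha_0$ is a ring homomorphism (into the Calkin algebra, the quotient of $\mathrm{End}_{\mathbb{C}}(\mathbb{C}[x])$ by that ideal). The Calkin cocycle is $\sigma_0(P,Q)=\mathrm{tr}(\alpha_0([P,Q])-[\alpha_0(P),\alpha_0(Q)])$, where $\mathrm{tr}$ is the trace of finite-rank maps; it is a Lie algebra 2-cocycle for the commutator bracket. $\mathbb{C}[z,z^{-1}][\frac{\partial}{\partial z}]$ is the algebra of differential operators with Laurent polynomial coefficients, viewed as a Lie algebra under the commutator (the Lie algebra of differential operators on the circle), and $g:\mathbb{C}[z,z^{-1}][\frac{\partial}{\partial z}]\to\mathbb{C}[x]\langle\partial,\partial^{-1}\rangle$ is the $\mathbb{C}$-algebra isomorphism with $g(z)=\partial$, $g(\frac{\partial}{\partial z})=-x$. The Kac cocycle $\tau$ is the 2-cocycle of Kac giving the unique nontrivial one-dimensional central extension of this Lie algebra; in its standard normalization, for $f,h\in\mathbb{C}[z,z^{-1}]$ and $m,n\ge0$, $$\tau\Bigl(f\tfrac{\partial^m}{\partial z^m},\,h\tfrac{\partial^n}{\partial z^n}\Bigr)=\frac{m!\,n!}{(m+n+1)!}\,\mathrm{Res}_{z=0}\bigl(f^{(n+1)}\,h^{(m)}\bigr),$$ where $f^{(k)}$ is the $k$-th derivative and $\mathrm{Res}_{z=0}$ is the coefficient of $z^{-1}$.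
   Formalization: The equality is proved with a sign, σ₁ = −τ: with the stated normalizations of σ₀, g and τ, σ₁ = τ fails, since σ₁(z, z⁻¹) = −tr(DL − LD) = −1 while τ(z, z⁻¹) = Res(z⁻¹) = 1. *)

theory Defs
  imports
    Complex_Main
    "HOL-Computational_Algebra.Polynomial"
    "HOL-Computational_Algebra.Fraction_Field"
    "HOL-Library.Poly_Mapping"
begin

section \<open>Differential rings\<close>

class differential_ring = comm_ring_1 +
  fixes der :: "'a \<Rightarrow> 'a"
  assumes der_add: "der (a + b) = der a + der b"
    and der_mult: "der (a * b) = der a * b + a * der b"
begin

lemma der_0 [simp]: "der 0 = 0"
  using der_add[of 0 0] by simp

lemma der_1 [simp]: "der 1 = 0"
  using der_mult[of 1 1] by simp

lemma der_minus: "der (- a) = - der a"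
  using der_add[of a "- a"] by (simp add: eq_neg_iff_add_eq_0 add.commute)

lemma der_diff: "der (a - b) = der a - der b"
  using der_add[of a "- b"] by (simp add: der_minus)

end

instantiation poly :: (idom) differential_ring
begin
definition "der_poly = (pderiv :: 'a poly \<Rightarrow> 'a poly)"
instance
  by standard (simp_all add: der_poly_def pderiv_add pderiv_mult algebra_simps)
end

instantiation fract :: ("{idom, differential_ring}") differential_ring
begin

lift_definition der_fract :: "'a fract \<Rightarrow> 'a fract"
  is "\<lambda>(p, q). (der p * q - p * der q, q * q)"
proof -
  fix x y :: "'a \<times> 'a"
  assume "fractrel x y"
  moreover obtain p q where x: "x = (p, q)" by fastforce
  moreover obtain r s where y: "y = (r, s)" by fastforce
  ultimately have q: "q \<noteq> 0" and s: "s \<noteq> 0" and eq: "p * s = r * q" by auto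
  from eq have "der (p * s) = der (r * q)" by simp
  then have d: "der p * s + p * der s = der r * q + r * der q" by (simp add: der_mult)
  have "(der p * q - p * der q) * (s * s) - (der r * s - r * der s) * (q * q)
      = (der p * s + p * der s - (der r * q + r * der q)) * (q * s)
        - (p * s - r * q) * (der q * s + der s * q)"
    by (simp add: algebra_simps)
  also have "\<dots> = 0" using d eq by simp
  finally show "fractrel (case x of (p, q) \<Rightarrow> (der p * q - p * der q, q * q))
      (case y of (p, q) \<Rightarrow> (der p * q - p * der q, q * q))"
    using q s x y by simp
qed

lemma der_Fract: "q \<noteq> 0 \<Longrightarrow> der (Fract p q) = Fract (der p * q - p * der q) (q * q)"
  by transfer auto

instance
proof
  fix a b :: "'a fract"
  obtain p q where a: "a = Fract p q" "q \<noteq> 0" by (cases a) auto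
  obtain r s where b: "b = Fract r s" "s \<noteq> 0" by (cases b) auto
  show "der (a + b) = der a + der b"
    using a b by (simp add: der_Fract eq_fract der_add der_mult) (simp add: algebra_simps)
  show "der (a * b) = der a * b + a * der b"
    using a b by (simp add: der_Fract eq_fract der_add der_mult) (simp add: algebra_simps)
qed

end

text \<open>\<open>laurent\<close> is the ring \<open>\<complex>[z, z\<^sup>-\<^sup>1]\<close>, as the group ring of \<open>\<int>\<close>.\<close>

typedef laurent = "UNIV :: (int \<Rightarrow>\<^sub>0 complex) set" morphisms laurent_pm Laurent ..

setup_lifting type_definition_laurent

instantiation laurent :: idom
begin
lift_definition zero_laurent :: laurent is 0 .
lift_definition one_laurent :: laurent is 1 .
lift_definition plus_laurent :: "laurent \<Rightarrow> laurent \<Rightarrow> laurent" is "(+)" .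
lift_definition minus_laurent :: "laurent \<Rightarrow> laurent \<Rightarrow> laurent" is "(-)" .
lift_definition uminus_laurent :: "laurent \<Rightarrow> laurent" is "uminus" .
lift_definition times_laurent :: "laurent \<Rightarrow> laurent \<Rightarrow> laurent" is "(*)" .
instance by standard (transfer; simp add: algebra_simps)+
end

lift_definition lcoeff :: "laurent \<Rightarrow> int \<Rightarrow> complex" is Poly_Mapping.lookup .

lift_definition lmonom :: "complex \<Rightarrow> int \<Rightarrow> laurent" is "\<lambda>c k. Poly_Mapping.single k c" .

lift_definition lsupp :: "laurent \<Rightarrow> int set" is Poly_Mapping.keys .

lemma finite_lsupp [simp]: "finite (lsupp f)"
  by transfer simp

lemma in_lsupp_iff: "k \<in> lsupp f \<longleftrightarrow> lcoeff f k \<noteq> 0"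
  by transfer (simp add: in_keys_iff)

lemma laurent_eqI: "(\<And>k. lcoeff f k = lcoeff g k) \<Longrightarrow> f = g"
  by transfer (rule poly_mapping_eqI)

lemma lcoeff_add [simp]: "lcoeff (f + g) k = lcoeff f k + lcoeff g k"
  by transfer (simp add: lookup_add)

lemma lcoeff_0 [simp]: "lcoeff 0 k = 0"
  by transfer simp

lemma lcoeff_lmonom: "lcoeff (lmonom c n) k = (if n = k then c else 0)"
  by transfer (simp add: lookup_single when_def)

lemma lmonom_mult: "lmonom a m * lmonom b n = lmonom (a * b) (m + n)"
  by transfer (simp add: mult_single)

lemma lmonom_add: "lmonom a n + lmonom b n = lmonom (a + b) n"
  by transfer (simp add: single_add)

lemma lmonom_0 [simp]: "lmonom 0 n = 0"
  by transfer simp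

lemma lmonom_1: "lmonom 1 0 = 1"
  by transfer simp

lemma lcoeff_sum: "lcoeff (\<Sum>i\<in>A. F i) k = (\<Sum>i\<in>A. lcoeff (F i) k)"
  by (induction A rule: infinite_finite_induct) auto

lemma laurent_eq_sum: "f = (\<Sum>k\<in>lsupp f. lmonom (lcoeff f k) k)"
  by (rule laurent_eqI) (simp add: lcoeff_sum lcoeff_lmonom in_lsupp_iff)

lemma laurent_induct [case_names zero add]:
  assumes "P 0" "\<And>c k f. P f \<Longrightarrow> P (lmonom c k + f)"
  shows "P f"
proof -
  have "P (\<Sum>k\<in>A. lmonom (lcoeff f k) k)" if "finite A" for A
    using that by induction (auto intro: assms)
  then show ?thesis using laurent_eq_sum[of f] finite_lsupp[of f] by metis
qed

instantiation laurent :: differential_ring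
begin

definition der_laurent :: "laurent \<Rightarrow> laurent"
  where "der_laurent f = (\<Sum>k\<in>lsupp f. lmonom (of_int k * lcoeff f k) (k - 1))"

lemma lcoeff_der: "lcoeff (der f) k = of_int (k + 1) * lcoeff f (k + 1)"
proof -
  have "lcoeff (der f) k = (\<Sum>j\<in>lsupp f. if j = k + 1 then of_int j * lcoeff f j else 0)"
    unfolding der_laurent_def lcoeff_sum
    by (rule sum.cong) (auto simp: lcoeff_lmonom)
  then show ?thesis by (simp add: in_lsupp_iff)
qed

lemma der_lmonom: "der (lmonom c n) = lmonom (of_int n * c) (n - 1)"
  by (rule laurent_eqI) (auto simp: lcoeff_der lcoeff_lmonom)

instance
proof
  fix f g :: laurent
  have der_plus: "der (f + g) = der f + der g" for f g :: laurent
    by (rule laurent_eqI) (simp add: lcoeff_der algebra_simps)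
  show "der (f + g) = der f + der g" by (rule der_plus)
  have der0: "der (0 :: laurent) = 0"
    by (rule laurent_eqI) (simp add: lcoeff_der)
  have mono: "der (lmonom c n * g) = der (lmonom c n) * g + lmonom c n * der g" for c n
  proof (induction g rule: laurent_induct)
    case zero
    show ?case by (simp add: der0)
  next
    case (add d k h)
    have "der (lmonom c n * lmonom d k)
        = der (lmonom c n) * lmonom d k + lmonom c n * der (lmonom d k)"
      by (simp add: der_lmonom lmonom_mult)
        (simp add: algebra_simps flip: lmonom_add)
    with add.IH show ?case by (simp add: distrib_left der_plus)
  qed
  show "der (f * g) = der f * g + f * der g"
    by (induction f rule: laurent_induct)
      (simp_all add: der0 distrib_right der_plus mono)
qed

end


section \<open>Ordinary differential operators over a differential ring\<close>

text \<open>An element \<open>\<Sum>\<^sub>i a\<^sub>i \<partial>\<^sup>i\<close> is stored as the polynomial with coefficients \<open>a\<^sub>i\<close>.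
  \<open>dshift\<close> is left multiplication by \<open>\<partial>\<close>, read off from \<open>\<partial> a = a \<partial> + a'\<close>.\<close>

definition dshift :: "'a::differential_ring poly \<Rightarrow> 'a poly"
  where "dshift q = pCons 0 q + map_poly der q"

definition smul :: "'a::differential_ring poly \<Rightarrow> 'a poly \<Rightarrow> 'a poly"
  where "smul p q = (\<Sum>i\<le>degree p. smult (coeff p i) ((dshift ^^ i) q))"

lemma coeff_dshift: "coeff (dshift q) k = coeff (pCons 0 q) k + der (coeff q k)"
  by (simp add: dshift_def coeff_map_poly)

lemma smult_sum_right: "smult a (\<Sum>i\<in>A. f i) = (\<Sum>i\<in>A. smult a (f i))"
  by (induction A rule: infinite_finite_induct) (auto simp: smult_add_right)

lemma dshift_add: "dshift (p + q) = dshift p + dshift q"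
  by (rule poly_eqI) (auto simp: coeff_dshift der_add coeff_pCons split: nat.split)

lemma dshift_0 [simp]: "dshift 0 = 0"
  by (simp add: dshift_def)

lemma dshift_smult: "dshift (smult a q) = smult (der a) q + smult a (dshift q)"
  by (rule poly_eqI) (auto simp: coeff_dshift der_mult coeff_pCons algebra_simps split: nat.split)

lemma dshift_sum: "dshift (\<Sum>i\<in>A. f i) = (\<Sum>i\<in>A. dshift (f i))"
  by (induction A rule: infinite_finite_induct) (auto simp: dshift_add)

lemma dshift_funpow_add: "(dshift ^^ i) (p + q) = (dshift ^^ i) p + (dshift ^^ i) q"
  by (induction i) (auto simp: dshift_add)

lemma dshift_funpow_0 [simp]: "(dshift ^^ i) 0 = 0"
  by (induction i) auto

lemma smul_altdef:
  assumes "degree p \<le> n"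
  shows "smul p q = (\<Sum>i\<le>n. smult (coeff p i) ((dshift ^^ i) q))"
  unfolding smul_def
  by (rule sum.mono_neutral_left) (use assms in \<open>auto simp: coeff_eq_0\<close>)

lemma smul_0_left [simp]: "smul 0 q = 0"
  by (simp add: smul_def)

lemma smul_0_right [simp]: "smul q 0 = 0"
  by (simp add: smul_def)

lemma smul_add_left: "smul (p + q) r = smul p r + smul q r"
proof -
  define n where "n = max (degree p) (degree q)"
  have "degree (p + q) \<le> n" "degree p \<le> n" "degree q \<le> n"
    by (auto simp: n_def intro: degree_add_le)
  then show ?thesis by (simp add: smul_altdef smult_add_left sum.distrib)
qed

lemma smul_add_right: "smul r (p + q) = smul r p + smul r q"
  by (simp add: smul_def dshift_funpow_add smult_add_right sum.distrib)

lemma smul_smult_left: "smul (smult a p) q = smult a (smul p q)"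
proof -
  have "degree (smult a p) \<le> degree p" by (simp add: degree_smult_le)
  then show ?thesis by (simp add: smul_altdef[of _ "degree p"] smult_sum_right)
qed

lemma smul_pCons: "smul (pCons a p) q = smult a q + smul p (dshift q)"
proof -
  have "smul (pCons a p) q
      = (\<Sum>i\<le>Suc (degree p). smult (coeff (pCons a p) i) ((dshift ^^ i) q))"
    by (rule smul_altdef) (simp add: degree_pCons_le)
  also have "\<dots> = smult a q + (\<Sum>i\<le>degree p. smult (coeff p i) ((dshift ^^ Suc i) q))"
    by (subst sum.atMost_Suc_shift) simp
  finally show ?thesis by (simp add: smul_def funpow_Suc_right del: funpow.simps)
qed

lemma smul_sum_left: "smul (\<Sum>i\<in>A. f i) q = (\<Sum>i\<in>A. smul (f i) q)"
  by (induction A rule: infinite_finite_induct) (auto simp: smul_add_left)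

lemma smul_dshift_left: "smul (dshift p) q = dshift (smul p q)"
proof -
  have deg: "degree (map_poly der p) \<le> degree p"
    by (rule degree_le) (simp add: coeff_map_poly coeff_eq_0)
  have "dshift (smul p q) = (\<Sum>i\<le>degree p. smult (der (coeff p i)) ((dshift ^^ i) q))
      + (\<Sum>i\<le>degree p. smult (coeff p i) ((dshift ^^ i) (dshift q)))"
    by (simp add: smul_def dshift_sum dshift_smult sum.distrib funpow_swap1)
  also have "\<dots> = smul (map_poly der p) q + smul p (dshift q)"
    by (simp add: smul_altdef[OF deg] smul_altdef[of p "degree p"] coeff_map_poly)
  also have "\<dots> = smul (dshift p) q"
    by (simp add: dshift_def smul_add_left smul_pCons)
  finally show ?thesis by simp
qed

lemma smul_dshift_funpow_left: "smul ((dshift ^^ i) p) q = (dshift ^^ i) (smul p q)"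
  by (induction i) (auto simp: smul_dshift_left)

lemma smul_assoc: "smul (smul p q) r = smul p (smul q r)"
proof -
  have "smul (smul p q) r = (\<Sum>i\<le>degree p. smul (smult (coeff p i) ((dshift ^^ i) q)) r)"
    by (simp add: smul_def[of p q] smul_sum_left)
  then show ?thesis
    by (simp add: smul_smult_left smul_dshift_funpow_left smul_def[of p])
qed

lemma smul_1_left: "smul 1 q = q"
  by (simp add: smul_def)

lemma dshift_monom_1: "dshift (monom 1 i) = monom 1 (Suc i)"
  by (rule poly_eqI) (auto simp: coeff_dshift coeff_pCons split: nat.split)

lemma dshift_funpow_1: "(dshift ^^ i) 1 = monom 1 i"
  by (induction i) (auto simp: dshift_monom_1)

lemma smul_1_right: "smul q 1 = q"
  by (simp add: smul_def dshift_funpow_1 smult_monom poly_as_sum_of_monoms)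

typedef (overloaded) 'a diffop = "UNIV :: 'a::differential_ring poly set"
  morphisms diffop_poly Diffop ..

setup_lifting type_definition_diffop

instantiation diffop :: (differential_ring) ring_1
begin
lift_definition zero_diffop :: "'a diffop" is 0 .
lift_definition one_diffop :: "'a diffop" is 1 .
lift_definition plus_diffop :: "'a diffop \<Rightarrow> 'a diffop \<Rightarrow> 'a diffop" is "(+)" .
lift_definition minus_diffop :: "'a diffop \<Rightarrow> 'a diffop \<Rightarrow> 'a diffop" is "(-)" .
lift_definition uminus_diffop :: "'a diffop \<Rightarrow> 'a diffop" is "uminus" .
lift_definition times_diffop :: "'a diffop \<Rightarrow> 'a diffop \<Rightarrow> 'a diffop" is smul .
instance
  by standard
    (transfer; simp add: smul_add_left smul_add_right smul_assoc smul_1_left smul_1_right)+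
end

lift_definition dcoeff :: "'a::differential_ring diffop \<Rightarrow> nat \<Rightarrow> 'a" is coeff .

lift_definition dorder :: "'a::differential_ring diffop \<Rightarrow> nat" is degree .

lift_definition dconst :: "'a::differential_ring \<Rightarrow> 'a diffop" is "\<lambda>a. [:a:]" .

lift_definition dd :: "'a::differential_ring diffop" is "monom 1 1" .

lemma dconst_add: "dconst (a + b) = dconst a + dconst b"
  by transfer simp

lemma dconst_mult: "dconst (a * b) = dconst a * dconst b"
  by transfer (simp add: smul_def)

lemma dconst_0 [simp]: "dconst 0 = 0"
  by transfer simp

lemma dconst_1 [simp]: "dconst 1 = 1"
  by transfer simp

lemma dd_mult_dconst: "dd * dconst a = dconst a * dd + dconst (der a)"
proof transfer
  fix a :: 'a
  have "smul (monom 1 1) [:a:] = dshift [:a:]"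
    using smul_dshift_left[of 1 "[:a:]"] dshift_monom_1[of 0, where 'a = 'a]
    by (simp add: smul_1_left)
  also have "\<dots> = smul [:a:] (monom 1 1) + [:der a:]"
    by (simp add: dshift_def smul_def map_poly_pCons monom_altdef)
  finally show "smul (monom 1 1) [:a:] = smul [:a:] (monom 1 1) + [:der a:]" .
qed

lemma diffop_poly_dconst_dd_power: "diffop_poly (dconst a * dd ^ i) = monom a i"
proof -
  have dd: "diffop_poly (dd ^ i :: 'a diffop) = monom 1 i"
  proof (induction i)
    case 0
    show ?case by (simp add: one_diffop.rep_eq)
  next
    case (Suc i)
    have "smul (monom 1 1) (monom 1 i) = dshift (monom 1 i :: 'a poly)"
      using smul_dshift_left[of 1 "monom 1 i :: 'a poly"] dshift_monom_1[of 0, where 'a = 'a]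
      by (simp add: smul_1_left)
    with Suc show ?case by (simp add: times_diffop.rep_eq dd.rep_eq dshift_monom_1)
  qed
  have "diffop_poly (dconst a * dd ^ i) = smul [:a:] (monom 1 i)"
    by (simp only: times_diffop.rep_eq dd dconst.rep_eq)
  then show ?thesis by (simp add: smul_def smult_monom)
qed

lemma diffop_eq_sum: "A = (\<Sum>i\<le>dorder A. dconst (dcoeff A i) * dd ^ i)"
proof -
  have sum: "diffop_poly (\<Sum>i\<in>S. F i) = (\<Sum>i\<in>S. diffop_poly (F i))"
    for S :: "nat set" and F :: "nat \<Rightarrow> 'a diffop"
    by (induction S rule: infinite_finite_induct)
      (auto simp: zero_diffop.rep_eq plus_diffop.rep_eq)
  have "diffop_poly (\<Sum>i\<le>dorder A. dconst (dcoeff A i) * dd ^ i) = diffop_poly A"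
    by (simp add: sum diffop_poly_dconst_dd_power dcoeff.rep_eq dorder.rep_eq
        poly_as_sum_of_monoms)
  then show ?thesis by (simp add: diffop_poly_inject)
qed


section \<open>The division ring of fractions of a left Ore domain\<close>

class ore_domain = ring_1_no_zero_divisors +
  assumes left_ore: "a \<noteq> 0 \<Longrightarrow> b \<noteq> 0 \<Longrightarrow> \<exists>u v. u * a = v * b \<and> u * a \<noteq> 0"
begin

lemma left_ore': "s \<noteq> 0 \<Longrightarrow> \<exists>u v. u \<noteq> 0 \<and> u * a = v * s"
proof (cases "a = 0")
  case True
  then have "1 \<noteq> 0 \<and> 1 * a = 0 * s" by simp
  then show ?thesis by blast
next
  case False
  assume "s \<noteq> 0"
  with False left_ore[of a s] show ?thesis by auto
qed

text \<open>The pair \<open>(a, s)\<close> stands for the fraction \<open>s\<^sup>-\<^sup>1 a\<close>.\<close>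

definition orerel :: "'a \<times> 'a \<Rightarrow> 'a \<times> 'a \<Rightarrow> bool"
  where "orerel x y \<longleftrightarrow> snd x \<noteq> 0 \<and> snd y \<noteq> 0 \<and>
    (\<exists>u v. u * snd x = v * snd y \<and> u * snd x \<noteq> 0 \<and> u * fst x = v * fst y)"

lemma orerelI:
  "s \<noteq> 0 \<Longrightarrow> t \<noteq> 0 \<Longrightarrow> u * s = v * t \<Longrightarrow> u * s \<noteq> 0 \<Longrightarrow> u * a = v * b \<Longrightarrow> orerel (a, s) (b, t)"
  unfolding orerel_def fst_conv snd_conv by blast

lemma orerelE:
  assumes "orerel (a, s) (b, t)"
  obtains u v where "s \<noteq> 0" "t \<noteq> 0" "u * s = v * t" "u * s \<noteq> 0" "u * a = v * b"
  using assms unfolding orerel_def fst_conv snd_conv by blast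

lemma orerel_key:
  assumes rel: "orerel (a, s) (a', s')" and eq: "k * s = l * s'"
  shows "k * a = l * a'"
proof -
  from rel obtain x y where s: "s \<noteq> 0" "s' \<noteq> 0"
    and xy: "x * s = y * s'" "x * s \<noteq> 0" "x * a = y * a'"
    by (rule orerelE)
  show ?thesis
  proof (cases "k = 0")
    case True
    with eq have "l * s' = 0" by simp
    with s have "l = 0" by simp
    with True show ?thesis by simp
  next
    case False
    moreover have "x \<noteq> 0" using xy(2) by auto
    ultimately obtain m n where mn: "m * k = n * x" "m * k \<noteq> 0"
      using left_ore by blast
    have "(n * y) * s' = n * (x * s)" using xy by (simp add: mult.assoc)
    also have "\<dots> = (m * k) * s" using mn by (simp add: mult.assoc)
    also have "\<dots> = (m * l) * s'" using eq by (simp add: mult.assoc)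
    finally have ny: "n * y = m * l" using s(2) by simp
    have "m * (k * a) = (n * x) * a" using mn by (simp flip: mult.assoc)
    also have "\<dots> = (n * y) * a'" using xy by (simp add: mult.assoc)
    also have "\<dots> = m * (l * a')" using ny by (simp add: mult.assoc)
    finally have "m * (k * a) = m * (l * a')" .
    moreover have "m \<noteq> 0" using mn(2) by auto
    ultimately show ?thesis by simp
  qed
qed

lemma orerel_refl: "s \<noteq> 0 \<Longrightarrow> orerel (a, s) (a, s)"
  by (rule orerelI[of _ _ 1 1]) auto

lemma orerel_scale: "u \<noteq> 0 \<Longrightarrow> s \<noteq> 0 \<Longrightarrow> orerel (u * a, u * s) (a, s)"
  by (rule orerelI[of _ _ 1 u]) auto

lemma symp_orerel: "symp orerel"
  unfolding orerel_def by (rule sympI) metis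

lemma transp_orerel: "transp orerel"
proof (rule transpI)
  fix x y z
  assume xy: "orerel x y" and yz: "orerel y z"
  obtain a s b t c r where [simp]: "x = (a, s)" "y = (b, t)" "z = (c, r)"
    by (metis prod.exhaust)
  from xy obtain u v where uv: "u * s = v * t" "u * s \<noteq> 0" "u * a = v * b"
    by (auto elim: orerelE)
  from yz obtain p q where pq: "p * t = q * r" "p * t \<noteq> 0" "p * b = q * c"
    by (auto elim: orerelE)
  have nz: "s \<noteq> 0" "t \<noteq> 0" "r \<noteq> 0" "v \<noteq> 0" "p \<noteq> 0"
    using uv pq by (metis mult_zero_left mult_zero_right)+
  then obtain m n where mn: "m * v = n * p" "m * v \<noteq> 0" using left_ore by blast
  have "(m * u) * s = (m * v) * t" using uv by (simp add: mult.assoc)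
  also have "\<dots> = n * (p * t)" using mn by (simp add: mult.assoc)
  also have "\<dots> = (n * q) * r" using pq by (simp add: mult.assoc)
  finally have 1: "(m * u) * s = (n * q) * r" .
  have "(m * u) * s = (m * v) * t" using uv by (simp add: mult.assoc)
  then have 2: "(m * u) * s \<noteq> 0" using mn nz by simp
  have "(m * u) * a = (m * v) * b" using uv by (simp add: mult.assoc)
  also have "\<dots> = n * (p * b)" using mn by (simp add: mult.assoc)
  also have "\<dots> = (n * q) * c" using pq by (simp add: mult.assoc)
  finally have 3: "(m * u) * a = (n * q) * c" .
  show "orerel x z"
    using nz 1 2 3 by (simp add: orerelI[of s r "m * u" "n * q"])
qed

lemma part_equivp_orerel: "part_equivp orerel"
  using orerel_refl[of 1 0] symp_orerel transp_orerel by (intro part_equivpI) auto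

text \<open>Multipliers for a common denominator \<open>u s = v t \<noteq> 0\<close> in a sum, and for the
  exchange \<open>a t\<^sup>-\<^sup>1 = u\<^sup>-\<^sup>1 v\<close> in a product.\<close>

definition ore_plus :: "'a \<times> 'a \<Rightarrow> 'a \<times> 'a \<Rightarrow> 'a \<times> 'a"
  where "ore_plus x y =
    (let (u, v) = SOME (u, v). u * snd x = v * snd y \<and> u * snd x \<noteq> 0
     in (u * fst x + v * fst y, u * snd x))"

definition ore_times :: "'a \<times> 'a \<Rightarrow> 'a \<times> 'a \<Rightarrow> 'a \<times> 'a"
  where "ore_times x y =
    (let (u, v) = SOME (u, v). u \<noteq> 0 \<and> u * fst x = v * snd y
     in (v * fst y, u * snd x))"

lemma ore_plusE:
  assumes "s \<noteq> 0" "t \<noteq> 0"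
  obtains u v where "u * s = v * t" "u * s \<noteq> 0"
    "ore_plus (a, s) (b, t) = (u * a + v * b, u * s)"
proof -
  obtain u v where uv: "(SOME (u, v). u * s = v * t \<and> u * s \<noteq> 0) = (u, v)"
    by fastforce
  have "\<exists>p. case p of (u, v) \<Rightarrow> u * s = v * t \<and> u * s \<noteq> 0"
    using left_ore[OF assms] by auto
  from someI_ex[OF this, unfolded uv prod.case] have "u * s = v * t \<and> u * s \<noteq> 0" .
  moreover have "ore_plus (a, s) (b, t) = (u * a + v * b, u * s)"
    unfolding ore_plus_def fst_conv snd_conv uv Let_def by simp
  ultimately show ?thesis using that by blast
qed

lemma ore_timesE:
  assumes "t \<noteq> 0"
  obtains u v where "u \<noteq> 0" "u * a = v * t"
    "ore_times (a, s) (b, t) = (v * b, u * s)"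
proof -
  obtain u v where uv: "(SOME (u, v). u \<noteq> 0 \<and> u * a = v * t) = (u, v)"
    by fastforce
  have "\<exists>p. case p of (u, v) \<Rightarrow> u \<noteq> 0 \<and> u * a = v * t"
    using left_ore'[OF assms] by auto
  from someI_ex[OF this, unfolded uv prod.case] have "u \<noteq> 0 \<and> u * a = v * t" .
  moreover have "ore_times (a, s) (b, t) = (v * b, u * s)"
    unfolding ore_times_def fst_conv snd_conv uv Let_def by simp
  ultimately show ?thesis using that by blast
qed

lemma orerel_plus:
  assumes rel: "orerel (a, s) (a', s')" "orerel (b, t) (b', t')"
    and uv: "u * s = v * t" "u * s \<noteq> 0" "u' * s' = v' * t'" "u' * s' \<noteq> 0"
  shows "orerel (u * a + v * b, u * s) (u' * a' + v' * b', u' * s')"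
proof -
  obtain m n where mn: "m * (u * s) = n * (u' * s')" "m * (u * s) \<noteq> 0"
    using left_ore uv by blast
  have "(m * u) * a = (n * u') * a'"
    by (rule orerel_key[OF rel(1)]) (use mn in \<open>simp add: mult.assoc\<close>)
  moreover have "(m * v) * b = (n * v') * b'"
    by (rule orerel_key[OF rel(2)]) (use mn uv in \<open>simp add: mult.assoc\<close>)
  ultimately have "m * (u * a + v * b) = n * (u' * a' + v' * b')"
    by (simp add: distrib_left mult.assoc)
  with mn uv show ?thesis by (intro orerelI[of _ _ m n]) auto
qed

lemma orerel_times:
  assumes rel: "orerel (a, s) (a', s')" "orerel (b, t) (b', t')"
    and uv: "u \<noteq> 0" "u * a = v * t" "u' \<noteq> 0" "u' * a' = v' * t'"
  shows "orerel (v * b, u * s) (v' * b', u' * s')"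
proof -
  have nz: "s \<noteq> 0" "s' \<noteq> 0" using rel by (auto simp: orerel_def)
  then have "u * s \<noteq> 0" "u' * s' \<noteq> 0" using uv(1,3) by auto
  then obtain m n where mn: "m * (u * s) = n * (u' * s')" "m * (u * s) \<noteq> 0"
    using left_ore by blast
  have "(m * u) * a = (n * u') * a'"
    by (rule orerel_key[OF rel(1)]) (use mn in \<open>simp add: mult.assoc\<close>)
  then have "(m * v) * t = (n * v') * t'" using uv by (simp add: mult.assoc)
  then have "(m * v) * b = (n * v') * b'" by (rule orerel_key[OF rel(2)])
  with mn \<open>u * s \<noteq> 0\<close> \<open>u' * s' \<noteq> 0\<close> show ?thesis
    by (intro orerelI[of _ _ m n]) (auto simp: mult.assoc)
qed

end

quotient_type (overloaded) 'a ore_fract = "'a::ore_domain \<times> 'a" / partial: orerel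
  by (rule part_equivp_orerel)

lift_definition OreFract :: "'a::ore_domain \<Rightarrow> 'a \<Rightarrow> 'a ore_fract"
  is "\<lambda>a s. if s = 0 then (0, 1) else (a, s)"
  by (simp add: orerel_refl)

lemma OreFract_cases [cases type: ore_fract]:
  obtains a s where "q = OreFract a s" "s \<noteq> 0"
  by transfer (auto simp: orerel_def split: if_splits)

lemma OreFract_eq_iff:
  "s \<noteq> 0 \<Longrightarrow> t \<noteq> 0 \<Longrightarrow> OreFract a s = OreFract b t \<longleftrightarrow> orerel (a, s) (b, t)"
  by transfer simp

lemma OreFract_cancel: "u \<noteq> 0 \<Longrightarrow> s \<noteq> 0 \<Longrightarrow> OreFract (u * a) (u * s) = OreFract a s"
  by (simp add: OreFract_eq_iff orerel_scale)

lemma OreFract_same_denom_iff: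
  assumes "s \<noteq> 0"
  shows "OreFract a s = OreFract b s \<longleftrightarrow> a = b"
  using assms orerel_key[of a s b s 1 1] by (auto simp: OreFract_eq_iff orerel_refl)

lemma OreFract_common_denom:
  fixes x y :: "'a::ore_domain ore_fract"
  obtains a b s where "x = OreFract a s" "y = OreFract b s" "s \<noteq> 0"
proof -
  obtain a s where x: "x = OreFract a s" "s \<noteq> 0" by (cases x)
  obtain b t where y: "y = OreFract b t" "t \<noteq> 0" by (cases y)
  obtain u v where uv: "u * s = v * t" "u * s \<noteq> 0" using left_ore x y by blast
  then have "u \<noteq> 0" "v \<noteq> 0" by auto
  then have "x = OreFract (u * a) (u * s)" "y = OreFract (v * b) (v * t)"
    using x y by (simp_all add: OreFract_cancel)
  then have "x = OreFract (u * a) (u * s)" "y = OreFract (v * b) (u * s)"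
    by (simp_all only: uv(1))
  with uv show ?thesis by (intro that)
qed

lemma OreFract_common_denom3:
  fixes x y z :: "'a::ore_domain ore_fract"
  obtains a b c s where "x = OreFract a s" "y = OreFract b s" "z = OreFract c s" "s \<noteq> 0"
proof -
  obtain a b s where xy: "x = OreFract a s" "y = OreFract b s" "s \<noteq> 0"
    by (rule OreFract_common_denom)
  obtain c t where z: "z = OreFract c t" "t \<noteq> 0" by (cases z)
  obtain u v where uv: "u * s = v * t" "u * s \<noteq> 0" using left_ore xy z by blast
  then have "u \<noteq> 0" "v \<noteq> 0" by auto
  then have "x = OreFract (u * a) (u * s)" "y = OreFract (u * b) (u * s)"
    "z = OreFract (v * c) (u * s)"
    using xy z uv(1) OreFract_cancel by metis+
  with uv show ?thesis by (intro that)
qed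

text \<open>Every pair of fractions can be written as \<open>s\<^sup>-\<^sup>1 v t\<close> and \<open>t\<^sup>-\<^sup>1 b\<close>.\<close>

lemma OreFract_exchange:
  fixes x :: "'a::ore_domain ore_fract"
  assumes "t \<noteq> 0"
  obtains v s where "x = OreFract (v * t) s" "s \<noteq> 0"
proof -
  obtain a s where x: "x = OreFract a s" "s \<noteq> 0" by (cases x)
  obtain u v where uv: "u \<noteq> 0" "u * a = v * t" using left_ore' assms by blast
  then have "x = OreFract (v * t) (u * s)" using x OreFract_cancel by metis
  moreover have "u * s \<noteq> 0" using uv(1) x(2) by simp
  ultimately show ?thesis by (rule that)
qed

instantiation ore_fract :: (ore_domain) division_ring
begin

lift_definition zero_ore_fract :: "'a ore_fract" is "(0, 1)"
  by (simp add: orerel_refl)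

lift_definition one_ore_fract :: "'a ore_fract" is "(1, 1)"
  by (simp add: orerel_refl)

lift_definition plus_ore_fract :: "'a ore_fract \<Rightarrow> 'a ore_fract \<Rightarrow> 'a ore_fract" is ore_plus
proof -
  fix x x' y y' :: "'a \<times> 'a"
  assume rel: "orerel x x'" "orerel y y'"
  obtain a s a' s' b t b' t' where [simp]: "x = (a, s)" "x' = (a', s')" "y = (b, t)" "y' = (b', t')"
    by (metis prod.exhaust)
  have nz: "s \<noteq> 0" "s' \<noteq> 0" "t \<noteq> 0" "t' \<noteq> 0" using rel by (auto simp: orerel_def)
  obtain u v where 1: "u * s = v * t" "u * s \<noteq> 0"
    "ore_plus (a, s) (b, t) = (u * a + v * b, u * s)"
    using nz by (blast elim: ore_plusE)
  obtain u' v' where 2: "u' * s' = v' * t'" "u' * s' \<noteq> 0"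
    "ore_plus (a', s') (b', t') = (u' * a' + v' * b', u' * s')"
    using nz by (blast elim: ore_plusE)
  show "orerel (ore_plus x y) (ore_plus x' y')"
    using orerel_plus[OF rel[simplified] 1(1,2) 2(1,2)] 1(3) 2(3) by simp
qed

lift_definition uminus_ore_fract :: "'a ore_fract \<Rightarrow> 'a ore_fract" is "\<lambda>(a, s). (- a, s)"
proof -
  fix x y :: "'a \<times> 'a"
  assume "orerel x y"
  moreover obtain a s b t where [simp]: "x = (a, s)" "y = (b, t)" by (metis prod.exhaust)
  ultimately have "orerel (a, s) (b, t)" by simp
  then have "orerel (- a, s) (- b, t)"
    by (elim orerelE) (rule orerelI, assumption+, simp)
  then show "orerel (case x of (a, s) \<Rightarrow> (- a, s)) (case y of (a, s) \<Rightarrow> (- a, s))" by simp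
qed

definition "x - y = x + - y" for x y :: "'a ore_fract"

lift_definition times_ore_fract :: "'a ore_fract \<Rightarrow> 'a ore_fract \<Rightarrow> 'a ore_fract" is ore_times
proof -
  fix x x' y y' :: "'a \<times> 'a"
  assume rel: "orerel x x'" "orerel y y'"
  obtain a s a' s' b t b' t' where [simp]: "x = (a, s)" "x' = (a', s')" "y = (b, t)" "y' = (b', t')"
    by (metis prod.exhaust)
  have nz: "t \<noteq> 0" "t' \<noteq> 0" using rel by (auto simp: orerel_def)
  obtain u v where 1: "u \<noteq> 0" "u * a = v * t"
    "ore_times (a, s) (b, t) = (v * b, u * s)"
    using nz by (blast elim: ore_timesE)
  obtain u' v' where 2: "u' \<noteq> 0" "u' * a' = v' * t'"
    "ore_times (a', s') (b', t') = (v' * b', u' * s')"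
    using nz by (blast elim: ore_timesE)
  show "orerel (ore_times x y) (ore_times x' y')"
    using orerel_times[OF rel[simplified] 1(1,2) 2(1,2)] 1(3) 2(3) by simp
qed

lift_definition inverse_ore_fract :: "'a ore_fract \<Rightarrow> 'a ore_fract"
  is "\<lambda>(a, s). if a = 0 then (0, 1) else (s, a)"
proof -
  fix x x' :: "'a \<times> 'a"
  assume rel: "orerel x x'"
  obtain a s a' s' where [simp]: "x = (a, s)" "x' = (a', s')" by (metis prod.exhaust)
  from rel have "orerel (a, s) (a', s')" by simp
  then obtain u v where uv: "s \<noteq> 0" "s' \<noteq> 0" "u * s = v * s'" "u * s \<noteq> 0" "u * a = v * a'"
    by (rule orerelE)
  then have nz: "u \<noteq> 0" "v \<noteq> 0" by (metis mult_zero_left)+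
  with uv have iff: "a = 0 \<longleftrightarrow> a' = 0" by (metis mult_eq_0_iff)
  have "orerel (s, a) (s', a')" if "a \<noteq> 0"
    using that iff uv nz by (intro orerelI[of _ _ u v]) auto
  with iff show "orerel (case x of (a, s) \<Rightarrow> if a = 0 then (0, 1) else (s, a))
      (case x' of (a, s) \<Rightarrow> if a = 0 then (0, 1) else (s, a))"
    by (auto simp: orerel_refl)
qed

definition "x div y = x * inverse y" for x y :: "'a ore_fract"

lemma OreFract_0 [simp]: "OreFract 0 s = 0"
proof (cases "s = 0")
  case True
  then show ?thesis by transfer (simp add: orerel_refl)
next
  case False
  have "OreFract (s * 0) (s * 1) = OreFract 0 1" by (rule OreFract_cancel) (use False in auto)
  also have "\<dots> = 0" by transfer (simp add: orerel_refl)
  finally show ?thesis by simp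
qed

lemma one_ore_fract_eq: "1 = OreFract 1 1"
  by transfer (simp add: orerel_refl)

lemma OreFract_self: "s \<noteq> 0 \<Longrightarrow> OreFract s s = 1"
  using OreFract_cancel[of s 1 1] by (simp add: one_ore_fract_eq)

lemma OreFract_add:
  assumes "s \<noteq> 0"
  shows "OreFract a s + OreFract b s = OreFract (a + b) s"
proof -
  obtain u v where uv: "u * s = v * s" "u * s \<noteq> 0"
    "ore_plus (a, s) (b, s) = (u * a + v * b, u * s)"
    using assms by (blast elim: ore_plusE)
  have "u = v" using uv assms by simp
  then have "orerel (ore_plus (a, s) (b, s)) (u * (a + b), u * s)"
    using uv assms by (simp add: distrib_left orerel_refl)
  moreover have "orerel (u * (a + b), u * s) (a + b, s)"
    using uv assms by (intro orerel_scale) auto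
  ultimately have "orerel (ore_plus (a, s) (b, s)) (a + b, s)"
    using transp_orerel by (blast dest: transpD)
  then show ?thesis using assms by transfer simp
qed

lemma OreFract_minus: "s \<noteq> 0 \<Longrightarrow> - OreFract a s = OreFract (- a) s"
  by transfer (simp add: orerel_refl)

lemma OreFract_mult:
  assumes "s \<noteq> 0" "t \<noteq> 0"
  shows "OreFract (v * t) s * OreFract b t = OreFract (v * b) s"
proof -
  obtain u w where uw: "u \<noteq> 0" "u * (v * t) = w * t"
    "ore_times (v * t, s) (b, t) = (w * b, u * s)"
    using assms by (blast elim: ore_timesE)
  have "w * t = (u * v) * t" using uw by (simp add: mult.assoc)
  then have "w = u * v" using assms by simp
  then have "orerel (ore_times (v * t, s) (b, t)) (v * b, s)"
    using uw assms orerel_scale[of u s "v * b"] by (simp add: mult.assoc)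
  then show ?thesis using assms by transfer simp
qed

lemma OreFract_inverse: "a \<noteq> 0 \<Longrightarrow> s \<noteq> 0 \<Longrightarrow> inverse (OreFract a s) = OreFract s a"
  by transfer (simp add: orerel_refl)

instance
proof
  fix x y z :: "'a ore_fract"
  obtain a b c s where xyz: "x = OreFract a s" "y = OreFract b s" "z = OreFract c s" "s \<noteq> 0"
    by (rule OreFract_common_denom3)
  show "x + y + z = x + (y + z)" using xyz by (simp add: OreFract_add add.assoc)
  show "x + y = y + x" using xyz by (simp add: OreFract_add add.commute)
  show "0 + x = x" using xyz OreFract_add[of s 0 a] by simp
  show "- x + x = 0" using xyz by (simp add: OreFract_add OreFract_minus)
  show "x - y = x + - y" by (simp add: minus_ore_fract_def)
  show "x div y = x * inverse y" by (simp add: divide_ore_fract_def)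
  show "(0 :: 'a ore_fract) \<noteq> 1"
    using OreFract_same_denom_iff[of 1 0 "1 :: 'a"] by (simp add: one_ore_fract_eq)
  show "inverse (0 :: 'a ore_fract) = 0" by transfer (simp add: orerel_refl)
  show "1 * x = x"
    using xyz OreFract_mult[of s s 1 a] by (simp add: OreFract_self)
  show "x * 1 = x"
    using xyz OreFract_mult[of s 1 a 1] by (simp add: one_ore_fract_eq)
  show "inverse x * x = 1" if "x \<noteq> 0"
  proof -
    have "a \<noteq> 0" using that xyz by auto
    then show ?thesis using xyz OreFract_mult[of a s 1 a]
      by (simp add: OreFract_inverse OreFract_self)
  qed
  show "x * inverse x = 1" if "x \<noteq> 0"
  proof -
    have "a \<noteq> 0" using that xyz by auto
    then show ?thesis using xyz OreFract_mult[of s a 1 s]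
      by (simp add: OreFract_inverse OreFract_self)
  qed
  show "x * (y + z) = x * y + x * z"
  proof -
    obtain v t where x: "x = OreFract (v * s) t" "t \<noteq> 0"
      using xyz(4) by (rule OreFract_exchange)
    then show ?thesis using xyz(2-4) by (simp add: OreFract_add OreFract_mult distrib_left)
  qed
  show "(x + y) * z = x * z + y * z"
  proof -
    obtain d r where z: "z = OreFract d r" "r \<noteq> 0" by (cases z)
    obtain u v where uv: "u \<noteq> 0" "u * a = v * r" using left_ore' z by blast
    obtain u' v' where uv': "u' \<noteq> 0" "u' * (u * b) = v' * r" using left_ore' z by blast
    define w where "w = u' * (u * s)"
    have w: "w \<noteq> 0" using uv(1) uv'(1) xyz(4) by (simp add: w_def)
    have "x = OreFract (u' * (u * a)) w" "y = OreFract (u' * (u * b)) w"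
      using xyz uv(1) uv'(1) by (simp_all add: w_def OreFract_cancel)
    then have xy: "x = OreFract ((u' * v) * r) w" "y = OreFract (v' * r) w"
      unfolding uv(2) uv'(2) mult.assoc by this
    then have "x + y = OreFract ((u' * v + v') * r) w"
      using w by (simp add: OreFract_add distrib_right)
    then have 1: "(x + y) * z = OreFract ((u' * v + v') * d) w"
      using OreFract_mult[OF w z(2)] z(1) by metis
    have "x * z = OreFract (u' * v * d) w" "y * z = OreFract (v' * d) w"
      using OreFract_mult[OF w z(2)] z(1) xy by metis+
    with 1 w show ?thesis by (simp add: OreFract_add distrib_right)
  qed
  show "x * y * z = x * (y * z)"
  proof -
    obtain d r where z: "z = OreFract d r" "r \<noteq> 0" by (cases z)
    obtain v t where y: "y = OreFract (v * r) t" "t \<noteq> 0" using z(2) by (rule OreFract_exchange)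
    obtain w p where x: "x = OreFract (w * t) p" "p \<noteq> 0" using y(2) by (rule OreFract_exchange)
    have "x * y = OreFract ((w * v) * r) p"
      using x y by (simp add: OreFract_mult mult.assoc)
    then have 1: "x * y * z = OreFract (w * v * d) p"
      by (simp only: OreFract_mult z x not_False_eq_True)
    have "y * z = OreFract (v * d) t" using y z by (simp add: OreFract_mult)
    then have "x * (y * z) = OreFract (w * (v * d)) p" using x y by (simp add: OreFract_mult)
    with 1 show ?thesis by (simp add: mult.assoc)
  qed
qed

end

definition to_ore_fract :: "'a::ore_domain \<Rightarrow> 'a ore_fract"
  where "to_ore_fract a = OreFract a 1"

lemma to_ore_fract_add: "to_ore_fract (a + b) = to_ore_fract a + to_ore_fract b"
  by (simp add: to_ore_fract_def OreFract_add)

lemma to_ore_fract_mult: "to_ore_fract (a * b) = to_ore_fract a * to_ore_fract b"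
  using OreFract_mult[of 1 1 a b] by (simp add: to_ore_fract_def)

lemma to_ore_fract_0 [simp]: "to_ore_fract 0 = 0"
  by (simp add: to_ore_fract_def)

lemma to_ore_fract_1 [simp]: "to_ore_fract 1 = 1"
  by (simp add: to_ore_fract_def OreFract_self)

lemma to_ore_fract_eq_iff [simp]: "to_ore_fract a = to_ore_fract b \<longleftrightarrow> a = b"
  by (simp add: to_ore_fract_def OreFract_same_denom_iff)

lemma OreFract_conv_inverse: "s \<noteq> 0 \<Longrightarrow> OreFract a s = inverse (to_ore_fract s) * to_ore_fract a"
  using OreFract_mult[of s 1 1 a] by (simp add: to_ore_fract_def OreFract_inverse)


text \<open>Differential operators over a differential field form a left Ore domain, by the
  Euclidean algorithm for division on the right.\<close>

lemma degree_dshift: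
  fixes q :: "'a::differential_ring poly"
  assumes "q \<noteq> 0"
  shows "degree (dshift q) = Suc (degree q)" "lead_coeff (dshift q) = lead_coeff q"
proof -
  have "coeff (dshift q) (Suc (degree q)) = lead_coeff q"
    by (simp add: coeff_dshift coeff_eq_0)
  moreover have "degree (dshift q) \<le> Suc (degree q)"
    by (rule degree_le) (auto simp: coeff_dshift coeff_eq_0 coeff_pCons split: nat.split)
  ultimately show "degree (dshift q) = Suc (degree q)" "lead_coeff (dshift q) = lead_coeff q"
    using assms by (metis le_antisym le_degree leading_coeff_0_iff)+
qed

lemma degree_dshift_funpow:
  fixes q :: "'a::differential_ring poly"
  assumes "q \<noteq> 0"
  shows "degree ((dshift ^^ i) q) = i + degree q \<and> lead_coeff ((dshift ^^ i) q) = lead_coeff q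
    \<and> (dshift ^^ i) q \<noteq> 0"
proof (induction i)
  case (Suc i)
  then show ?case using degree_dshift[of "(dshift ^^ i) q"] assms
    by (metis add_Suc funpow.simps(2) comp_apply leading_coeff_0_iff)
qed (use assms in auto)

lemma smul_nonzero:
  fixes p q :: "'a::{idom, differential_ring} poly"
  assumes "p \<noteq> 0" "q \<noteq> 0"
  shows "smul p q \<noteq> 0"
proof -
  define f where "f i = smult (coeff p i) ((dshift ^^ i) q)" for i
  have "coeff (f i) (degree p + degree q) = 0" if "i < degree p" for i
    using degree_dshift_funpow[OF assms(2), of i] that by (simp add: f_def coeff_eq_0)
  then have "coeff (smul p q) (degree p + degree q)
      = (\<Sum>i\<le>degree p. if i = degree p then coeff (f i) (degree p + degree q) else 0)"
    unfolding smul_def coeff_sum f_def[symmetric] by (intro sum.cong) auto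
  also have "\<dots> = lead_coeff p * lead_coeff q"
  proof -
    have "coeff ((dshift ^^ degree p) q) (degree p + degree q) = lead_coeff q"
      using degree_dshift_funpow[OF assms(2), of "degree p"] by metis
    then show ?thesis by (simp add: f_def)
  qed
  finally show ?thesis using assms by auto
qed

lemma smul_division:
  fixes p q :: "'a::{field, differential_ring} poly"
  assumes "q \<noteq> 0"
  shows "\<exists>w r. p = smul w q + r \<and> (r = 0 \<or> degree r < degree q)"
proof (induction "degree p" arbitrary: p rule: less_induct)
  case less
  show ?case
  proof (cases "p = 0 \<or> degree p < degree q")
    case True
    then have "p = smul 0 q + p \<and> (p = 0 \<or> degree p < degree q)" by simp
    then show ?thesis by blast
  next
    case False
    define n where "n = degree p - degree q"
    define c where "c = lead_coeff p / lead_coeff q"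
    define h where "h = smult c ((dshift ^^ n) q)"
    have h: "h = smul (monom c n) q"
    proof (cases "c = 0")
      case False
      then show ?thesis by (simp add: smul_def h_def degree_monom_eq coeff_monom if_distrib
            if_distribR cong: if_cong)
    qed (simp add: h_def)
    have c: "c \<noteq> 0" using False assms by (simp add: c_def)
    have deg: "degree h = degree p" "lead_coeff h = lead_coeff p"
    proof -
      have "degree ((dshift ^^ n) q) = degree p"
        using degree_dshift_funpow[OF assms, of n] False by (simp add: n_def)
      moreover have "coeff ((dshift ^^ n) q) (degree p) = lead_coeff q"
        using degree_dshift_funpow[OF assms, of n] calculation by metis
      ultimately show "degree h = degree p" "lead_coeff h = lead_coeff p"
        using c assms by (simp_all add: h_def c_def)
    qed
    have "p - h = 0 \<or> degree (p - h) < degree p"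
    proof (cases "degree p = 0")
      case True
      with deg have "p - h = 0" by (metis degree_0_id diff_self)
      then show ?thesis ..
    next
      case False
      have "degree (p - h) \<le> degree p" using deg by (simp add: degree_diff_le)
      moreover have "coeff (p - h) (degree p) = 0" using deg by simp
      ultimately show ?thesis
        by (metis le_neq_implies_less leading_coeff_0_iff)
    qed
    then have "\<exists>w r. p - h = smul w q + r \<and> (r = 0 \<or> degree r < degree q)"
    proof
      assume "p - h = 0"
      then have "p - h = smul 0 q + 0 \<and> (0 = 0 \<or> degree 0 < degree q)" by simp
      then show ?thesis by blast
    qed (rule less)
    then obtain w r where wr: "p - h = smul w q + r" "r = 0 \<or> degree r < degree q" by blast
    then have "p = smul (w + monom c n) q + r"
      by (simp add: smul_add_left h algebra_simps)
    with wr show ?thesis by blast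
  qed
qed

instance diffop :: ("{idom, differential_ring}") ring_1_no_zero_divisors
  by standard (transfer, simp add: smul_nonzero)

instance diffop :: ("{field, differential_ring}") ore_domain
proof
  fix a b :: "'a diffop"
  show "\<exists>u v. u * a = v * b \<and> u * a \<noteq> 0" if "a \<noteq> 0" "b \<noteq> 0"
    using that
  proof (induction "dorder b" arbitrary: a b rule: less_induct)
    case less
    have "\<exists>w r. a = w * b + r \<and> (r = 0 \<or> dorder r < dorder b)"
      using less.prems(2) by transfer (rule smul_division)
    then obtain w r where wr: "a = w * b + r" "r = 0 \<or> dorder r < dorder b" by blast
    show ?case
    proof (cases "r = 0")
      case True
      then have "1 * a = w * b \<and> 1 * a \<noteq> 0" using wr(1) less.prems(1) by simp
      then show ?thesis by blast
    next
      case False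
      then obtain u v where uv: "u * b = v * r" "u * b \<noteq> 0"
        using less.hyps[of r b] wr less.prems by blast
      have "v * a = v * w * b + v * r" by (simp add: wr(1) distrib_left mult.assoc)
      then have "v * a = (v * w + u) * b" by (simp add: distrib_right uv(1))
      moreover have "v \<noteq> 0" using uv by (metis mult_zero_left)
      then have "v * a \<noteq> 0" using less.prems(1) by simp
      ultimately show ?thesis by blast
    qed
  qed
qed


section \<open>The ring \<open>\<complex>[x]\<langle>\<partial>, \<partial>\<^sup>-\<^sup>1\<rangle>\<close>\<close>

text \<open>The division ring of fractions of \<open>\<complex>(x)\<langle>\<partial>\<rangle>\<close>.\<close>

type_synonym pdo = "complex poly fract diffop ore_fract"

definition emb :: "complex poly \<Rightarrow> pdo"
  where "emb p = to_ore_fract (dconst (Fract p 1))"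

definition ddx :: pdo
  where "ddx = to_ore_fract dd"

inductive_set psido :: "pdo set"
  where
    emb: "emb p \<in> psido"
  | ddx: "ddx \<in> psido"
  | inverse_ddx: "inverse ddx \<in> psido"
  | add: "P \<in> psido \<Longrightarrow> Q \<in> psido \<Longrightarrow> P + Q \<in> psido"
  | minus: "P \<in> psido \<Longrightarrow> - P \<in> psido"
  | mult: "P \<in> psido \<Longrightarrow> Q \<in> psido \<Longrightarrow> P * Q \<in> psido"

lemma emb_add: "emb (p + q) = emb p + emb q"
proof -
  have "Fract (p + q) 1 = Fract p 1 + Fract q 1" by simp
  then show ?thesis by (simp only: emb_def dconst_add to_ore_fract_add)
qed

lemma emb_mult: "emb (p * q) = emb p * emb q"
proof -
  have "Fract (p * q) 1 = Fract p 1 * Fract q 1" by simp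
  then show ?thesis by (simp only: emb_def dconst_mult to_ore_fract_mult)
qed

lemma emb_1 [simp]: "emb 1 = 1"
  by (simp add: emb_def flip: One_fract_def)

lemma emb_0 [simp]: "emb 0 = 0"
  by (simp add: emb_def flip: Zero_fract_def)

lemma emb_minus: "emb (- p) = - emb p"
  using emb_add[of p "- p"] by (simp add: eq_neg_iff_add_eq_0 add.commute)

lemma emb_diff: "emb (p - q) = emb p - emb q"
  using emb_add[of p "- q"] by (simp add: emb_minus)

lemma emb_sum: "emb (\<Sum>i\<in>A. f i) = (\<Sum>i\<in>A. emb (f i))"
  by (induction A rule: infinite_finite_induct) (auto simp: emb_add)

lemma emb_of_nat: "emb (of_nat n) = of_nat n"
  by (induction n) (auto simp: emb_add)

lemma emb_of_int: "emb (of_int n) = of_int n"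
  by (cases n rule: int_cases2) (auto simp: emb_of_nat emb_minus)

lemma ddx_mult_emb: "ddx * emb p = emb p * ddx + emb (pderiv p)"
proof -
  have "der (Fract p 1) = Fract (pderiv p) 1"
    by (simp add: der_Fract der_poly_def)
  then show ?thesis
    unfolding emb_def ddx_def by (simp add: dd_mult_dconst flip: to_ore_fract_mult to_ore_fract_add)
qed

lemma ddx_emb_const: "ddx * emb [:c:] = emb [:c:] * ddx"
  by (simp add: ddx_mult_emb pderiv_pCons)

lemma to_ore_fract_power: "to_ore_fract (a ^ n) = to_ore_fract a ^ n"
  by (induction n) (auto simp: to_ore_fract_mult)

lemma to_ore_fract_sum: "to_ore_fract (\<Sum>i\<in>A. f i) = (\<Sum>i\<in>A. to_ore_fract (f i))"
  by (induction A rule: infinite_finite_induct) (auto simp: to_ore_fract_add)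

lemma dcoeff_add: "dcoeff (A + B) i = dcoeff A i + dcoeff B i"
  by transfer simp

lemma dcoeff_0 [simp]: "dcoeff 0 i = 0"
  by transfer simp

lemma dcoeff_sum: "dcoeff (\<Sum>j\<in>S. F j) i = (\<Sum>j\<in>S. dcoeff (F j) i)"
  by (induction S rule: infinite_finite_induct) (auto simp: dcoeff_add)

lemma dcoeff_dconst_dd_power: "dcoeff (dconst a * dd ^ j) i = (if i = j then a else 0)"
  by (simp add: dcoeff.rep_eq diffop_poly_dconst_dd_power)

lemma emb_ddx_independent:
  assumes "(\<Sum>i\<in>I. emb (p i) * ddx ^ i) = 0" "finite I" "i \<in> I"
  shows "p i = 0"
proof -
  have "(\<Sum>i\<in>I. emb (p i) * ddx ^ i) = to_ore_fract (\<Sum>i\<in>I. dconst (Fract (p i) 1) * dd ^ i)"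
    by (simp add: to_ore_fract_sum to_ore_fract_mult to_ore_fract_power emb_def ddx_def)
  with assms(1) have "to_ore_fract (\<Sum>i\<in>I. dconst (Fract (p i) 1) * dd ^ i) = to_ore_fract 0"
    by simp
  then have "(\<Sum>i\<in>I. dconst (Fract (p i) 1) * dd ^ i) = 0" by (simp only: to_ore_fract_eq_iff)
  then have "dcoeff (\<Sum>i\<in>I. dconst (Fract (p i) 1) * dd ^ i) i = 0" by simp
  then have "Fract (p i) 1 = 0"
    using assms(2,3) by (simp add: dcoeff_sum dcoeff_dconst_dd_power)
  then show ?thesis by (simp add: Zero_fract_def eq_fract)
qed

lemma ddx_nonzero [simp]: "ddx \<noteq> 0"
  using emb_ddx_independent[of "\<lambda>_. 1" "{1}" 1] by auto


section \<open>The map \<open>\<alpha>\<^sub>0\<close> and the Calkin cocycle\<close>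

definition integ :: "complex poly \<Rightarrow> complex poly"
  where "integ p = (\<Sum>k\<le>degree p. monom (coeff p k / of_nat (k + 1)) (k + 1))"

definition normal_elt ::
  "nat \<Rightarrow> (nat \<Rightarrow> complex poly) \<Rightarrow> nat \<Rightarrow> (nat \<Rightarrow> complex poly) \<Rightarrow> (nat \<Rightarrow> complex poly) \<Rightarrow> pdo"
  where "normal_elt n a m b c =
    (\<Sum>i=0..n. emb (a i) * ddx ^ i) + (\<Sum>j=1..m. emb (b j) * inverse ddx * emb (c j))"

definition normal_op ::
  "nat \<Rightarrow> (nat \<Rightarrow> complex poly) \<Rightarrow> nat \<Rightarrow> (nat \<Rightarrow> complex poly) \<Rightarrow> (nat \<Rightarrow> complex poly)
    \<Rightarrow> complex poly \<Rightarrow> complex poly"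
  where "normal_op n a m b c p =
    (\<Sum>i=0..n. a i * (pderiv ^^ i) p) + (\<Sum>j=1..m. b j * integ (c j * p))"

text \<open>The choice is unambiguous on elements with a normal form, by \<open>alpha0_normal_elt\<close> below;
  outside \<open>psido\<close> the value is irrelevant.\<close>

definition alpha0 :: "pdo \<Rightarrow> complex poly \<Rightarrow> complex poly"
  where "alpha0 P = (THE T. \<exists>n a m b c. P = normal_elt n a m b c \<and> T = normal_op n a m b c)"

text \<open>If \<open>T = \<Sum>\<^sub>i \<phi>\<^sub>i(\<cdot>) v\<^sub>i\<close> is a finite sum with linear forms \<open>\<phi>\<^sub>i\<close>, its trace is \<open>\<Sum>\<^sub>i \<phi>\<^sub>i(v\<^sub>i)\<close>.\<close>

definition finite_rank_rep ::
  "(complex poly \<Rightarrow> complex poly) \<Rightarrow> nat \<Rightarrow> (nat \<Rightarrow> complex poly \<Rightarrow> complex) \<Rightarrow> (nat \<Rightarrow> complex poly) \<Rightarrow> bool"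
  where "finite_rank_rep T n \<phi> v \<longleftrightarrow>
    (\<forall>i<n. Vector_Spaces.linear smult (*) (\<phi> i)) \<and> (\<forall>p. T p = (\<Sum>i<n. smult (\<phi> i p) (v i)))"

definition fr_trace :: "(complex poly \<Rightarrow> complex poly) \<Rightarrow> complex"
  where "fr_trace T = (THE t. \<exists>n \<phi> v. finite_rank_rep T n \<phi> v \<and> t = (\<Sum>i<n. \<phi> i (v i)))"

definition calkin_cocycle :: "pdo \<Rightarrow> pdo \<Rightarrow> complex"
  where "calkin_cocycle P Q =
    fr_trace (\<lambda>p. alpha0 (P * Q - Q * P) p - (alpha0 P (alpha0 Q p) - alpha0 Q (alpha0 P p)))"


subsection \<open>The trace is well defined\<close>

lemma finite_rank_rep_trace:
  assumes "finite_rank_rep T n \<phi> v" "\<And>i. i < n \<Longrightarrow> degree (v i) \<le> N"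
  shows "(\<Sum>i<n. \<phi> i (v i)) = (\<Sum>k\<le>N. coeff (T (monom 1 k)) k)"
proof -
  have lin: "\<phi> i (v i) = (\<Sum>k\<le>N. coeff (v i) k * \<phi> i (monom 1 k))" if "i < n" for i
  proof -
    interpret Vector_Spaces.linear smult "(*)" "\<phi> i"
      using assms(1) that by (simp add: finite_rank_rep_def)
    have "v i = (\<Sum>k\<le>N. smult (coeff (v i) k) (monom 1 k))"
      using poly_as_sum_of_monoms'[of "v i" N] assms(2)[OF that] by (simp add: smult_monom)
    then have "\<phi> i (v i) = \<phi> i (\<Sum>k\<le>N. smult (coeff (v i) k) (monom 1 k))" by simp
    also have "\<dots> = (\<Sum>k\<le>N. coeff (v i) k * \<phi> i (monom 1 k))" by (simp only: sum scale)
    finally show ?thesis .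
  qed
  have "(\<Sum>i<n. \<phi> i (v i)) = (\<Sum>i<n. \<Sum>k\<le>N. coeff (v i) k * \<phi> i (monom 1 k))"
    using lin by simp
  also have "\<dots> = (\<Sum>k\<le>N. \<Sum>i<n. \<phi> i (monom 1 k) * coeff (v i) k)"
    by (subst sum.swap) (simp add: mult.commute)
  also have "\<dots> = (\<Sum>k\<le>N. coeff (T (monom 1 k)) k)"
    using assms(1) by (simp add: finite_rank_rep_def coeff_sum)
  finally show ?thesis .
qed

lemma fr_trace_eq:
  assumes "finite_rank_rep T n \<phi> v"
  shows "fr_trace T = (\<Sum>i<n. \<phi> i (v i))"
  unfolding fr_trace_def
proof (rule the_equality)
  show "\<exists>n' \<psi> w. finite_rank_rep T n' \<psi> w \<and> (\<Sum>i<n. \<phi> i (v i)) = (\<Sum>i<n'. \<psi> i (w i))"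
    using assms by blast
next
  fix t
  assume "\<exists>n' \<psi> w. finite_rank_rep T n' \<psi> w \<and> t = (\<Sum>i<n'. \<psi> i (w i))"
  then obtain n' \<psi> w where rep: "finite_rank_rep T n' \<psi> w" and t: "t = (\<Sum>i<n'. \<psi> i (w i))"
    by blast
  define N where "N = Max (insert 0 ((\<lambda>i. degree (v i)) ` {..<n} \<union> (\<lambda>i. degree (w i)) ` {..<n'}))"
  have "degree (v i) \<le> N" if "i < n" for i unfolding N_def using that by (intro Max_ge) auto
  moreover have "degree (w i) \<le> N" if "i < n'" for i unfolding N_def using that by (intro Max_ge) auto
  ultimately show "t = (\<Sum>i<n. \<phi> i (v i))"
    using finite_rank_rep_trace[OF assms] finite_rank_rep_trace[OF rep] t by metis
qed


subsection \<open>\<open>\<alpha>\<^sub>0\<close> is well defined\<close>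

lemma integ_altdef:
  assumes "degree p \<le> n"
  shows "integ p = (\<Sum>k\<le>n. monom (coeff p k / of_nat (k + 1)) (k + 1))"
  unfolding integ_def
  by (rule sum.mono_neutral_left) (use assms in \<open>auto simp: coeff_eq_0\<close>)

lemma coeff_integ: "coeff (integ p) k = (if k = 0 then 0 else coeff p (k - 1) / of_nat k)"
proof -
  have "coeff (integ p) k
      = (\<Sum>j\<le>degree p + k. if j + 1 = k then coeff p j / of_nat (j + 1) else 0)"
    by (subst integ_altdef[of _ "degree p + k"]) (auto simp: coeff_sum intro!: sum.cong)
  also have "\<dots> = (if k = 0 then 0 else coeff p (k - 1) / of_nat k)"
  proof (cases k)
    case (Suc l)
    have "(\<Sum>j\<le>degree p + k. if j + 1 = k then coeff p j / of_nat (j + 1) else 0)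
        = (\<Sum>j\<le>degree p + k. if j = l then coeff p j / of_nat (j + 1) else 0)"
      by (rule sum.cong) (auto simp: Suc)
    then show ?thesis by (simp add: Suc)
  qed simp
  finally show ?thesis .
qed

lemma integ_add: "integ (p + q) = integ p + integ q"
  by (rule poly_eqI) (simp add: coeff_integ add_divide_distrib)

lemma integ_smult: "integ (smult a p) = smult a (integ p)"
  by (rule poly_eqI) (simp add: coeff_integ)

lemma integ_0 [simp]: "integ 0 = 0"
  by (rule poly_eqI) (simp add: coeff_integ)

lemma integ_sum: "integ (\<Sum>i\<in>A. f i) = (\<Sum>i\<in>A. integ (f i))"
  by (induction A rule: infinite_finite_induct) (auto simp: integ_add)

lemma inverse_ddx_emb_const: "inverse ddx * emb [:c:] = emb [:c:] * inverse ddx"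
  using mult_commute_imp_mult_inverse_commute[OF ddx_emb_const[of c]] by simp

text \<open>Both \<open>normal_elt\<close> and \<open>normal_op\<close> factor through the coefficients
  \<open>B\<^sub>k\<close> of \<open>\<Sum>\<^sub>j b\<^sub>j \<otimes> c\<^sub>j = \<Sum>\<^sub>k B\<^sub>k \<otimes> x\<^sup>k\<close>.\<close>

lemma normal_reduce:
  obtains N A B where
    "\<And>i. i > N \<Longrightarrow> A i = 0" "\<And>i. i > N \<Longrightarrow> B i = 0"
    "normal_elt n a m b c = (\<Sum>i\<le>N. emb (A i) * ddx ^ i)
      + (\<Sum>k\<le>N. emb (B k) * inverse ddx * emb (monom 1 k))"
    "\<And>p. normal_op n a m b c p = (\<Sum>i\<le>N. A i * (pderiv ^^ i) p)
      + (\<Sum>k\<le>N. B k * integ (monom 1 k * p))"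
proof -
  define M where "M = n + (\<Sum>j=1..m. degree (c j))"
  have M: "n \<le> M" "\<And>j. j \<in> {1..m} \<Longrightarrow> degree (c j) \<le> M"
    unfolding M_def by (auto intro!: trans_le_add2 member_le_sum)
  define A where "A i = (if i \<le> n then a i else 0)" for i
  define B where "B k = (if k \<le> M then \<Sum>j=1..m. smult (coeff (c j) k) (b j) else 0)" for k
  have c: "c j = (\<Sum>k\<le>M. [:coeff (c j) k:] * monom 1 k)" if "j \<in> {1..m}" for j
    using poly_as_sum_of_monoms'[OF M(2)[OF that]] by (simp add: smult_monom)
  have elt: "(\<Sum>j=1..m. emb (b j) * inverse ddx * emb (c j))
      = (\<Sum>k\<le>M. emb (B k) * inverse ddx * emb (monom 1 k))"
  proof -
    have "(\<Sum>j=1..m. emb (b j) * inverse ddx * emb (c j))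
        = (\<Sum>j=1..m. emb (b j) * inverse ddx * (\<Sum>k\<le>M. emb [:coeff (c j) k:] * emb (monom 1 k)))"
      by (intro sum.cong refl) (metis (no_types, lifting) c emb_mult emb_sum sum.cong)
    also have "\<dots> = (\<Sum>j=1..m. \<Sum>k\<le>M. emb (b j) * (inverse ddx * emb [:coeff (c j) k:]) * emb (monom 1 k))"
      by (simp add: sum_distrib_left mult.assoc)
    also have "\<dots> = (\<Sum>j=1..m. \<Sum>k\<le>M. emb (smult (coeff (c j) k) (b j)) * inverse ddx * emb (monom 1 k))"
    proof (intro sum.cong refl)
      fix j k
      have "smult (coeff (c j) k) (b j) = b j * [:coeff (c j) k:]" by simp
      then show "emb (b j) * (inverse ddx * emb [:coeff (c j) k:]) * emb (monom 1 k)
          = emb (smult (coeff (c j) k) (b j)) * inverse ddx * emb (monom 1 k)"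
        by (simp only: inverse_ddx_emb_const emb_mult mult.assoc)
    qed
    also have "\<dots> = (\<Sum>k\<le>M. emb (B k) * inverse ddx * emb (monom 1 k))"
      by (subst sum.swap) (simp add: B_def emb_sum sum_distrib_right)
    finally show ?thesis .
  qed
  have op: "(\<Sum>j=1..m. b j * integ (c j * p)) = (\<Sum>k\<le>M. B k * integ (monom 1 k * p))" for p
  proof -
    have "(\<Sum>j=1..m. b j * integ (c j * p))
        = (\<Sum>j=1..m. b j * (\<Sum>k\<le>M. smult (coeff (c j) k) (integ (monom 1 k * p))))"
    proof (intro sum.cong refl)
      fix j assume "j \<in> {1..m}"
      then have "c j * p = (\<Sum>k\<le>M. smult (coeff (c j) k) (monom 1 k * p))"
        by (subst c) (simp_all add: sum_distrib_right)
      then show "b j * integ (c j * p)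
          = b j * (\<Sum>k\<le>M. smult (coeff (c j) k) (integ (monom 1 k * p)))"
        by (simp add: integ_sum integ_smult)
    qed
    also have "\<dots> = (\<Sum>k\<le>M. B k * integ (monom 1 k * p))"
      by (simp add: sum_distrib_left, subst sum.swap) (simp add: B_def sum_distrib_right)
    finally show ?thesis .
  qed
  have "(\<Sum>i=0..n. emb (a i) * ddx ^ i) = (\<Sum>i\<le>M. emb (A i) * ddx ^ i)"
    by (rule sum.mono_neutral_cong_left) (use M(1) in \<open>auto simp: A_def\<close>)
  moreover have "(\<Sum>i=0..n. a i * (pderiv ^^ i) p) = (\<Sum>i\<le>M. A i * (pderiv ^^ i) p)" for p
    by (rule sum.mono_neutral_cong_left) (use M(1) in \<open>auto simp: A_def\<close>)
  ultimately have
    "normal_elt n a m b c = (\<Sum>i\<le>M. emb (A i) * ddx ^ i)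
      + (\<Sum>k\<le>M. emb (B k) * inverse ddx * emb (monom 1 k))"
    "normal_op n a m b c p = (\<Sum>i\<le>M. A i * (pderiv ^^ i) p)
      + (\<Sum>k\<le>M. B k * integ (monom 1 k * p))" for p
    unfolding normal_elt_def normal_op_def elt op by simp_all
  moreover have "A i = 0" "B i = 0" if "i > M" for i
    using that M(1) by (simp_all add: A_def B_def)
  ultimately show ?thesis by (intro that[of M A B])
qed

definition qcoeff :: "nat \<Rightarrow> nat \<Rightarrow> complex"
  where "qcoeff k j = (-1) ^ j * fact k / fact (k - j)"

lemma inverse_ddx_monom:
  "inverse ddx * emb (monom 1 k) * ddx ^ Suc k
    = (\<Sum>j\<le>k. emb (monom (qcoeff k j) (k - j)) * ddx ^ (k - j))"
proof (induction k)
  case 0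
  show ?case by (simp add: qcoeff_def monom_0 flip: one_pCons)
next
  case (Suc k)
  have x: "ddx * emb (monom 1 (Suc k)) = emb (monom 1 (Suc k)) * ddx + emb (monom (of_nat (Suc k)) k)"
    by (simp add: ddx_mult_emb pderiv_monom)
  have c: "emb (monom (of_nat (Suc k)) k) = emb [:of_nat (Suc k):] * emb (monom 1 k)"
    by (simp add: smult_monom flip: emb_mult)
  have "inverse ddx * emb (monom 1 (Suc k)) * ddx
      = inverse ddx * (ddx * emb (monom 1 (Suc k))) - inverse ddx * emb (monom (of_nat (Suc k)) k)"
    by (simp add: x algebra_simps)
  also have "inverse ddx * (ddx * emb (monom 1 (Suc k))) = emb (monom 1 (Suc k))"
    by (simp flip: mult.assoc)
  also have "inverse ddx * emb (monom (of_nat (Suc k)) k)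
      = emb [:of_nat (Suc k):] * (inverse ddx * emb (monom 1 k))"
    by (simp only: c inverse_ddx_emb_const flip: mult.assoc)
  finally have "inverse ddx * emb (monom 1 (Suc k)) * ddx
      = emb (monom 1 (Suc k)) - emb [:of_nat (Suc k):] * (inverse ddx * emb (monom 1 k))" .
  then have "inverse ddx * emb (monom 1 (Suc k)) * ddx ^ Suc (Suc k)
      = emb (monom 1 (Suc k)) * ddx ^ Suc k
        - emb [:of_nat (Suc k):] * (inverse ddx * emb (monom 1 k) * ddx ^ Suc k)"
    by (simp only: power_Suc[of ddx "Suc k"] left_diff_distrib flip: mult.assoc)
  also have "\<dots> = emb (monom 1 (Suc k)) * ddx ^ Suc k
      + (\<Sum>j\<le>k. emb (monom (qcoeff (Suc k) (Suc j)) (k - j)) * ddx ^ (k - j))"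
  proof -
    have "emb [:of_nat (Suc k):] * (emb (monom (qcoeff k j) (k - j)) * ddx ^ (k - j))
        = - (emb (monom (qcoeff (Suc k) (Suc j)) (k - j)) * ddx ^ (k - j))" for j
    proof -
      have "[:of_nat (Suc k):] * monom (qcoeff k j) (k - j)
          = - monom (qcoeff (Suc k) (Suc j)) (k - j)"
        by (simp add: smult_monom qcoeff_def minus_monom divide_simps)
      then have "emb [:of_nat (Suc k):] * emb (monom (qcoeff k j) (k - j))
          = - emb (monom (qcoeff (Suc k) (Suc j)) (k - j))"
        by (metis emb_minus emb_mult)
      then show ?thesis by (simp flip: mult.assoc)
    qed
    then show ?thesis unfolding Suc.IH sum_distrib_left by (simp add: sum_negf)
  qed
  also have "\<dots> = (\<Sum>j\<le>Suc k. emb (monom (qcoeff (Suc k) j) (Suc k - j)) * ddx ^ (Suc k - j))"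
  proof -
    have "qcoeff (Suc k) 0 = 1" by (simp add: qcoeff_def del: fact_Suc)
    then show ?thesis by (subst sum.atMost_Suc_shift) simp
  qed
  finally show ?case .
qed

lemma normal_elt_zero:
  assumes "(\<Sum>i\<le>N. emb (A i) * ddx ^ i) + (\<Sum>k\<le>N. emb (B k) * inverse ddx * emb (monom 1 k)) = 0"
  shows "\<forall>i\<le>N. A i = 0 \<and> B i = 0"
proof -
  define C where "C j = (\<Sum>k\<in>{j..N}. B k * monom (qcoeff k j) (k - j))" for j
  define p where "p l = (if l \<le> N then C (N - l) else A (l - Suc N))" for l
  have B_term: "emb (B k) * inverse ddx * emb (monom 1 k) * ddx ^ Suc N
      = (\<Sum>j\<le>k. emb (B k * monom (qcoeff k j) (k - j)) * ddx ^ (N - j))" if "k \<le> N" for k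
  proof -
    have "ddx ^ Suc N = ddx ^ Suc k * ddx ^ (N - k)" using that by (simp add: mult.assoc flip: power_add)
    then have "emb (B k) * inverse ddx * emb (monom 1 k) * ddx ^ Suc N
        = emb (B k) * (inverse ddx * emb (monom 1 k) * ddx ^ Suc k) * ddx ^ (N - k)"
      by (simp only: mult.assoc)
    also have "\<dots> = (\<Sum>j\<le>k. emb (B k * monom (qcoeff k j) (k - j)) * (ddx ^ (k - j) * ddx ^ (N - k)))"
      unfolding inverse_ddx_monom sum_distrib_left sum_distrib_right emb_mult by (simp only: mult.assoc)
    also have "\<dots> = (\<Sum>j\<le>k. emb (B k * monom (qcoeff k j) (k - j)) * ddx ^ (N - j))"
      using that by (intro sum.cong refl) (simp flip: power_add)
    finally show ?thesis .
  qed
  have "(\<Sum>k\<le>N. emb (B k) * inverse ddx * emb (monom 1 k)) * ddx ^ Suc N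
      = (\<Sum>k\<le>N. \<Sum>j\<le>k. emb (B k * monom (qcoeff k j) (k - j)) * ddx ^ (N - j))"
    using B_term by (simp add: sum_distrib_right del: power_Suc)
  also have "\<dots> = (\<Sum>j\<le>N. \<Sum>k\<in>{j..N}. emb (B k * monom (qcoeff k j) (k - j)) * ddx ^ (N - j))"
    by (subst (1 2) sum.Sigma)
      (auto intro!: sum.reindex_bij_witness[of _ "\<lambda>(j, k). (k, j)" "\<lambda>(k, j). (j, k)"])
  also have "\<dots> = (\<Sum>j\<le>N. emb (C j) * ddx ^ (N - j))"
    by (simp add: C_def emb_sum sum_distrib_right)
  also have "\<dots> = (\<Sum>l\<le>N. emb (p l) * ddx ^ l)"
    by (rule sum.reindex_bij_witness[of _ "\<lambda>l. N - l" "\<lambda>j. N - j"]) (auto simp: p_def)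
  finally have 1: "(\<Sum>k\<le>N. emb (B k) * inverse ddx * emb (monom 1 k)) * ddx ^ Suc N
      = (\<Sum>l\<le>N. emb (p l) * ddx ^ l)" .
  have "(\<Sum>i\<le>N. emb (A i) * ddx ^ i) * ddx ^ Suc N = (\<Sum>i\<le>N. emb (A i) * ddx ^ (i + Suc N))"
    by (simp only: sum_distrib_right mult.assoc power_add)
  also have "\<dots> = (\<Sum>l\<in>{Suc N..N + Suc N}. emb (p l) * ddx ^ l)"
    by (rule sum.reindex_bij_witness[of _ "\<lambda>l. l - Suc N" "\<lambda>i. i + Suc N"]) (auto simp: p_def)
  finally have 2: "(\<Sum>i\<le>N. emb (A i) * ddx ^ i) * ddx ^ Suc N
      = (\<Sum>l\<in>{Suc N..N + Suc N}. emb (p l) * ddx ^ l)" .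
  have "(\<Sum>l\<in>{..N} \<union> {Suc N..N + Suc N}. emb (p l) * ddx ^ l)
      = (\<Sum>l\<le>N. emb (p l) * ddx ^ l) + (\<Sum>l\<in>{Suc N..N + Suc N}. emb (p l) * ddx ^ l)"
    by (rule sum.union_disjoint) auto
  also have "\<dots> = ((\<Sum>i\<le>N. emb (A i) * ddx ^ i)
      + (\<Sum>k\<le>N. emb (B k) * inverse ddx * emb (monom 1 k))) * ddx ^ Suc N"
    by (simp only: distrib_right 1 2 add.commute)
  finally have sum0: "(\<Sum>l\<in>{..N} \<union> {Suc N..N + Suc N}. emb (p l) * ddx ^ l) = 0"
    by (simp only: assms mult_zero_left)
  have p0: "p l = 0" if "l \<le> N + Suc N" for l
    using emb_ddx_independent[OF sum0, of l] that by force
  have A0: "A i = 0" if "i \<le> N" for i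
    using p0[of "i + Suc N"] that by (simp add: p_def)
  have C0: "C j = 0" if "j \<le> N" for j
    using p0[of "N - j"] that by (simp add: p_def)
  have "B (N - d) = 0" if "d \<le> N" for d
    using that
  proof (induction d rule: less_induct)
    case (less d)
    define j where "j = N - d"
    have "B k = 0" if "k \<in> {j..N} - {j}" for k
    proof -
      have "N - k < d" "N - k \<le> N" "N - (N - k) = k" using that less.prems by (auto simp: j_def)
      then show ?thesis using less.IH[of "N - k"] by simp
    qed
    then have "C j = B j * monom (qcoeff j j) 0"
      unfolding C_def by (subst sum.remove[of _ j]) (auto simp: j_def)
    moreover have "monom (qcoeff j j) 0 \<noteq> 0" by (simp add: qcoeff_def)
    ultimately show ?case using C0[of j] by (simp add: j_def)
  qed
  then have "B i = 0" if "i \<le> N" for i using that by (metis diff_diff_cancel diff_le_self)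
  with A0 show ?thesis by simp
qed

lemma normal_op_unique:
  assumes "normal_elt n a m b c = normal_elt n' a' m' b' c'"
  shows "normal_op n a m b c = normal_op n' a' m' b' c'"
proof -
  obtain N A B where N: "\<And>i. i > N \<Longrightarrow> A i = 0" "\<And>i. i > N \<Longrightarrow> B i = 0"
    "normal_elt n a m b c = (\<Sum>i\<le>N. emb (A i) * ddx ^ i)
      + (\<Sum>k\<le>N. emb (B k) * inverse ddx * emb (monom 1 k))"
    "\<And>p. normal_op n a m b c p = (\<Sum>i\<le>N. A i * (pderiv ^^ i) p)
      + (\<Sum>k\<le>N. B k * integ (monom 1 k * p))"
    by (rule normal_reduce[of n a m b c]) blast
  obtain N' A' B' where N': "\<And>i. i > N' \<Longrightarrow> A' i = 0" "\<And>i. i > N' \<Longrightarrow> B' i = 0"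
    "normal_elt n' a' m' b' c' = (\<Sum>i\<le>N'. emb (A' i) * ddx ^ i)
      + (\<Sum>k\<le>N'. emb (B' k) * inverse ddx * emb (monom 1 k))"
    "\<And>p. normal_op n' a' m' b' c' p = (\<Sum>i\<le>N'. A' i * (pderiv ^^ i) p)
      + (\<Sum>k\<le>N'. B' k * integ (monom 1 k * p))"
    by (rule normal_reduce[of n' a' m' b' c']) blast
  define M where "M = max N N'"
  have ext: "(\<Sum>i\<le>K. f i) = (\<Sum>i\<le>M. f i)" if "\<And>i. i > K \<Longrightarrow> f i = 0" "K \<le> M"
    for f :: "nat \<Rightarrow> 'z::comm_monoid_add" and K
    using that by (intro sum.mono_neutral_left) auto
  have le: "N \<le> M" "N' \<le> M" by (auto simp: M_def)
  have e: "normal_elt n a m b c = (\<Sum>i\<le>M. emb (A i) * ddx ^ i)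
      + (\<Sum>k\<le>M. emb (B k) * inverse ddx * emb (monom 1 k))"
    unfolding N(3) using N(1,2) le
    by (intro arg_cong2[where f = "(+)"] ext) auto
  have e': "normal_elt n' a' m' b' c' = (\<Sum>i\<le>M. emb (A' i) * ddx ^ i)
      + (\<Sum>k\<le>M. emb (B' k) * inverse ddx * emb (monom 1 k))"
    unfolding N'(3) using N'(1,2) le
    by (intro arg_cong2[where f = "(+)"] ext) auto
  have "(\<Sum>i\<le>M. emb (A i - A' i) * ddx ^ i)
      + (\<Sum>k\<le>M. emb (B k - B' k) * inverse ddx * emb (monom 1 k))
      = normal_elt n a m b c - normal_elt n' a' m' b' c'"
    unfolding e e' by (simp add: emb_diff left_diff_distrib sum_subtractf)
  also have "\<dots> = 0" using assms by simp
  finally have eq: "\<forall>i\<le>M. A i - A' i = 0 \<and> B i - B' i = 0" by (rule normal_elt_zero)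
  have "A i = A' i" "B i = B' i" for i
    using eq N(1,2)[of i] N'(1,2)[of i] le by (cases "i \<le> M"; force)+
  then have "A = A'" "B = B'" by auto
  show ?thesis
  proof
    fix p
    have "normal_op n a m b c p = (\<Sum>i\<le>M. A i * (pderiv ^^ i) p)
        + (\<Sum>k\<le>M. B k * integ (monom 1 k * p))"
      unfolding N(4) using N(1,2) le
      by (intro arg_cong2[where f = "(+)"] ext) auto
    moreover have "normal_op n' a' m' b' c' p = (\<Sum>i\<le>M. A' i * (pderiv ^^ i) p)
        + (\<Sum>k\<le>M. B' k * integ (monom 1 k * p))"
      unfolding N'(4) using N'(1,2) le
      by (intro arg_cong2[where f = "(+)"] ext) auto
    ultimately show "normal_op n a m b c p = normal_op n' a' m' b' c' p"
      using \<open>A = A'\<close> \<open>B = B'\<close> by simp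
  qed
qed

lemma alpha0_normal_elt: "alpha0 (normal_elt n a m b c) = normal_op n a m b c"
  unfolding alpha0_def by (rule the_equality) (blast intro: normal_op_unique sym)+


section \<open>Differential operators on the circle\<close>

text \<open>In \<open>laurent diffop\<close>, the algebra \<open>\<complex>[z, z\<^sup>-\<^sup>1][\<partial>/\<partial>z]\<close>, \<open>dd\<close> is \<open>\<partial>/\<partial>z\<close>.\<close>

definition lemb :: "laurent \<Rightarrow> pdo"
  where "lemb f = (\<Sum>k\<in>lsupp f. emb [:lcoeff f k:] * ddx powi k)"

text \<open>\<open>gmap\<close> is the isomorphism determined by \<open>z \<mapsto> \<partial>\<close> and \<open>\<partial>/\<partial>z \<mapsto> - x\<close>.\<close>

definition gmap :: "laurent diffop \<Rightarrow> pdo"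
  where "gmap A = (\<Sum>m\<le>dorder A. lemb (dcoeff A m) * (- emb [:0, 1:]) ^ m)"

definition circle_cocycle :: "laurent diffop \<Rightarrow> laurent diffop \<Rightarrow> complex"
  where "circle_cocycle A B = calkin_cocycle (gmap A) (gmap B)"

definition residue0 :: "laurent \<Rightarrow> complex"
  where "residue0 f = lcoeff f (- 1)"

definition kac_cocycle :: "laurent diffop \<Rightarrow> laurent diffop \<Rightarrow> complex"
  where "kac_cocycle A B = (\<Sum>m\<le>dorder A. \<Sum>n\<le>dorder B.
    fact m * fact n / fact (m + n + 1)
      * residue0 ((der ^^ (n + 1)) (dcoeff A m) * (der ^^ m) (dcoeff B n)))"


subsection \<open>\<open>gmap\<close> is a \<open>\<complex>\<close>-algebra isomorphism onto \<open>psido\<close>\<close>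

lemma lemb_altdef:
  assumes "lsupp f \<subseteq> S" "finite S"
  shows "lemb f = (\<Sum>k\<in>S. emb [:lcoeff f k:] * ddx powi k)"
  unfolding lemb_def
  by (rule sum.mono_neutral_left) (use assms in \<open>auto simp: in_lsupp_iff\<close>)

lemma lemb_add: "lemb (f + g) = lemb f + lemb g"
proof -
  define S where "S = lsupp f \<union> lsupp g \<union> lsupp (f + g)"
  have S: "finite S" "lsupp f \<subseteq> S" "lsupp g \<subseteq> S" "lsupp (f + g) \<subseteq> S" by (auto simp: S_def)
  have "emb [:lcoeff f k + lcoeff g k:] = emb [:lcoeff f k:] + emb [:lcoeff g k:]" for k
    by (simp flip: emb_add)
  then show ?thesis using S by (simp add: lemb_altdef[of _ S] distrib_right sum.distrib)
qed

lemma lemb_0 [simp]: "lemb 0 = 0"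
  using lemb_add[of 0 0] by simp

lemma lemb_lmonom: "lemb (lmonom c k) = emb [:c:] * ddx powi k"
  by (subst lemb_altdef[of _ "{k}"]) (auto simp: in_lsupp_iff lcoeff_lmonom split: if_splits)

lemma emb_const_ddx_powi: "ddx powi k * emb [:c:] = emb [:c:] * ddx powi k"
proof -
  have "ddx ^ n * emb [:c:] = emb [:c:] * ddx ^ n" for n
    by (rule power_commuting_commutes) (rule ddx_emb_const)
  moreover have "inverse ddx ^ n * emb [:c:] = emb [:c:] * inverse ddx ^ n" for n
    by (rule power_commuting_commutes) (rule inverse_ddx_emb_const)
  ultimately show ?thesis by (simp add: power_int_def)
qed

lemma lemb_mult: "lemb (f * g) = lemb f * lemb g"
proof -
  have "lemb (lmonom c k * g) = lemb (lmonom c k) * lemb g" for c k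
  proof (induction g rule: laurent_induct)
    case (add d l h)
    have "lemb (lmonom c k * lmonom d l) = emb [:c:] * emb [:d:] * (ddx powi k * ddx powi l)"
      by (simp add: lmonom_mult lemb_lmonom power_int_add mult.commute[of d c] flip: emb_mult)
    also have "\<dots> = emb [:c:] * (emb [:d:] * ddx powi k) * ddx powi l"
      by (simp only: mult.assoc)
    also have "\<dots> = lemb (lmonom c k) * lemb (lmonom d l)"
      unfolding emb_const_ddx_powi[of k d, symmetric] lemb_lmonom mult.assoc ..
    finally show ?case using add.IH by (simp add: distrib_left lemb_add)
  qed simp
  then show ?thesis
    by (induction f rule: laurent_induct) (simp_all add: distrib_right lemb_add)
qed

abbreviation (input) "xx \<equiv> emb [:0, 1:]"

lemma ddx_powi_xx: "ddx powi k * xx - xx * ddx powi k = of_int k * ddx powi (k - 1)"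
proof -
  have one: "ddx * xx = xx * ddx + 1"
    by (simp add: ddx_mult_emb pderiv_pCons flip: one_pCons)
  have down: "ddx powi (i - 1) * ddx = ddx powi i" for i
    using power_int_add_1[of ddx "i - 1"] by simp
  have step: "ddx powi (k + 1) * xx - xx * ddx powi (k + 1)
      = (ddx powi k * xx - xx * ddx powi k) * ddx + ddx powi k" for k
  proof -
    have "ddx powi (k + 1) * xx = ddx powi k * (ddx * xx)" by (simp add: power_int_add_1 mult.assoc)
    also have "\<dots> = ddx powi k * xx * ddx + ddx powi k"
      by (simp add: one distrib_left mult.assoc)
    finally show ?thesis by (simp add: power_int_add_1 left_diff_distrib mult.assoc)
  qed
  show ?thesis
  proof (induction k rule: int_induct[where k = 0])
    case base
    show ?case by simp
  next
    case (step1 i)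
    have "of_int i * ddx powi (i - 1) * ddx + ddx powi i = of_int (i + 1) * ddx powi i"
      by (simp add: mult.assoc down distrib_right)
    with step[of i] step1.IH show ?case by simp
  next
    case (step2 i)
    have "(ddx powi (i - 1) * xx - xx * ddx powi (i - 1)) * ddx
        = of_int i * ddx powi (i - 1) - ddx powi (i - 1)"
      using step[of "i - 1"] step2.IH by (simp add: algebra_simps)
    also have "\<dots> = of_int (i - 1) * ddx powi (i - 1)" by (simp add: left_diff_distrib)
    also have "\<dots> = of_int (i - 1) * ddx powi (i - 1 - 1) * ddx"
      by (simp only: mult.assoc down)
    finally show ?case by (simp only: mult_right_cancel[OF ddx_nonzero])
  qed
qed

lemma lemb_xx: "lemb f * xx - xx * lemb f = lemb (der f)"
proof (induction f rule: laurent_induct)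
  case zero
  show ?case by simp
next
  case (add c k f)
  have comm: "xx * emb [:c:] = emb [:c:] * xx" by (simp flip: emb_mult)
  have int: "emb [:of_int k:] = of_int k" using emb_of_int[of k] by (simp add: of_int_poly)
  have "lemb (lmonom c k) * xx - xx * lemb (lmonom c k)
      = emb [:c:] * (ddx powi k * xx - xx * ddx powi k)"
    by (simp add: lemb_lmonom right_diff_distrib comm flip: mult.assoc)
  also have "\<dots> = emb [:c:] * emb [:of_int k:] * ddx powi (k - 1)"
    by (simp only: ddx_powi_xx int mult.assoc)
  also have "\<dots> = lemb (der (lmonom c k))"
    by (simp add: der_lmonom lemb_lmonom mult.commute flip: emb_mult)
  finally show ?case using add.IH
    by (simp add: lemb_add der_add distrib_left distrib_right algebra_simps)
qed

lemma gmap_altdef: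
  assumes "dorder A \<le> n"
  shows "gmap A = (\<Sum>m\<le>n. lemb (dcoeff A m) * (- xx) ^ m)"
proof -
  have "dcoeff A m = 0" if "m > dorder A" for m
    using that by transfer (simp add: coeff_eq_0)
  then show ?thesis unfolding gmap_def
    by (intro sum.mono_neutral_left) (use assms in auto)
qed

lemma gmap_add: "gmap (A + B) = gmap A + gmap B"
proof -
  define n where "n = max (dorder (A + B)) (max (dorder A) (dorder B))"
  have "dorder A \<le> n" "dorder B \<le> n" "dorder (A + B) \<le> n" by (auto simp: n_def)
  then show ?thesis
    by (simp add: gmap_altdef dcoeff_add lemb_add distrib_right sum.distrib)
qed

lemma gmap_0 [simp]: "gmap 0 = 0"
  using gmap_add[of 0 0] by simp

lemma gmap_sum: "gmap (\<Sum>i\<in>S. F i) = (\<Sum>i\<in>S. gmap (F i))"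
  by (induction S rule: infinite_finite_induct) (auto simp: gmap_add)

lemma gmap_minus: "gmap (- A) = - gmap A"
  using gmap_add[of A "- A"] by (simp add: eq_neg_iff_add_eq_0 add.commute)

lemma gmap_monom: "gmap (dconst f * dd ^ m) = lemb f * (- xx) ^ m"
proof -
  have "dorder (dconst f * dd ^ m) \<le> m"
    by (simp add: dorder.rep_eq diffop_poly_dconst_dd_power degree_monom_le)
  then have "gmap (dconst f * dd ^ m)
      = (\<Sum>i\<le>m. lemb (dcoeff (dconst f * dd ^ m) i) * (- xx) ^ i)"
    by (rule gmap_altdef)
  also have "\<dots> = (\<Sum>i\<le>m. if i = m then lemb f * (- xx) ^ i else 0)"
    by (intro sum.cong refl) (simp add: dcoeff_dconst_dd_power)
  finally show ?thesis by simp
qed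

lemma lemb_1 [simp]: "lemb 1 = 1"
  using lemb_lmonom[of 1 0] by (simp add: lmonom_1 flip: one_pCons)

lemma gmap_1 [simp]: "gmap 1 = 1"
  using gmap_monom[of 1 0] by simp

lemma gmap_dconst: "gmap (dconst f) = lemb f"
  using gmap_monom[of f 0] by simp

lemma gmap_dd: "gmap dd = - emb [:0, 1:]"
  using gmap_monom[of 1 1] by simp

lemma gmap_scalar: "gmap (dconst (lmonom c 0)) = emb [:c:]"
  by (simp add: gmap_dconst lemb_lmonom)

lemma gmap_z: "gmap (dconst (lmonom 1 1)) = ddx"
  by (simp add: gmap_dconst lemb_lmonom flip: one_pCons)

lemma gmap_z_inverse: "gmap (dconst (lmonom 1 (- 1))) = inverse ddx"
  by (simp add: gmap_dconst lemb_lmonom flip: one_pCons)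

lemma gmap_mult: "gmap (A * B) = gmap A * gmap B"
proof -
  have const: "gmap (dconst f * B) = lemb f * gmap B" for f B
  proof -
    have "gmap (dconst f * B) = gmap (\<Sum>i\<le>dorder B. dconst (f * dcoeff B i) * dd ^ i)"
      by (subst diffop_eq_sum[of B]) (simp add: sum_distrib_left dconst_mult mult.assoc)
    also have "\<dots> = lemb f * gmap B"
      by (simp only: gmap_sum gmap_monom gmap_def[of B] lemb_mult sum_distrib_left mult.assoc)
    finally show ?thesis .
  qed
  have dd_monom: "gmap (dd * (dconst f * dd ^ m)) = - xx * gmap (dconst f * dd ^ m)" for f m
  proof -
    have "dd * (dconst f * dd ^ m) = dconst f * dd ^ Suc m + dconst (der f) * dd ^ m"
      by (simp add: dd_mult_dconst distrib_right mult.assoc flip: mult.assoc[of dd])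
    then have "gmap (dd * (dconst f * dd ^ m))
        = lemb f * (- xx) ^ Suc m + lemb (der f) * (- xx) ^ m"
      by (simp only: gmap_add gmap_monom)
    also have "\<dots> = (lemb f * (- xx) + lemb (der f)) * (- xx) ^ m"
      by (simp only: power_Suc distrib_right mult.assoc)
    also have "lemb f * (- xx) + lemb (der f) = - xx * lemb f"
      by (simp flip: lemb_xx)
    finally show ?thesis by (simp only: gmap_monom mult.assoc)
  qed
  have dd: "gmap (dd * B) = - xx * gmap B" for B
  proof -
    have "gmap (dd * B) = gmap (dd * (\<Sum>i\<le>dorder B. dconst (dcoeff B i) * dd ^ i))"
      using diffop_eq_sum[of B] by simp
    also have "\<dots> = (\<Sum>i\<le>dorder B. - xx * gmap (dconst (dcoeff B i) * dd ^ i))"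
      by (simp only: sum_distrib_left gmap_sum dd_monom)
    also have "\<dots> = - xx * gmap (\<Sum>i\<le>dorder B. dconst (dcoeff B i) * dd ^ i)"
      by (simp only: sum_distrib_left gmap_sum)
    finally show ?thesis using diffop_eq_sum[of B] by simp
  qed
  have dd_pow: "gmap (dd ^ i * B) = (- xx) ^ i * gmap B" for i
    by (induction i) (simp_all only: power_0 power_Suc mult_1_left mult.assoc dd)
  have "gmap (A * B) = gmap ((\<Sum>i\<le>dorder A. dconst (dcoeff A i) * dd ^ i) * B)"
    using diffop_eq_sum[of A] by simp
  also have "\<dots> = (\<Sum>i\<le>dorder A. lemb (dcoeff A i) * ((- xx) ^ i * gmap B))"
    by (simp only: sum_distrib_right gmap_sum mult.assoc const dd_pow)
  also have "\<dots> = gmap A * gmap B"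
    by (simp only: gmap_def sum_distrib_right mult.assoc)
  finally show ?thesis .
qed

lemma lemb_eq_0: "lemb f = 0 \<Longrightarrow> f = 0"
proof (rule laurent_eqI)
  fix k
  assume f: "lemb f = 0"
  define N where "N = Max (insert 0 ((\<lambda>k. nat (- k)) ` lsupp f))"
  have N: "k + int N \<ge> 0" if "k \<in> lsupp f" for k
  proof -
    have "nat (- k) \<le> N" unfolding N_def using that by (intro Max_ge) auto
    then show ?thesis by linarith
  qed
  have "0 = lemb f * ddx powi int N" using f by simp
  also have "\<dots> = (\<Sum>k\<in>lsupp f. emb [:lcoeff f k:] * ddx ^ nat (k + int N))"
    unfolding lemb_def sum_distrib_right
  proof (intro sum.cong refl)
    fix k assume "k \<in> lsupp f"
    from N[OF this] have "ddx powi k * ddx powi int N = ddx ^ nat (k + int N)"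
      using power_int_add[of ddx k "int N"] power_int_nonneg_exp[of "k + int N" ddx] by simp
    then show "emb [:lcoeff f k:] * ddx powi k * ddx powi int N
        = emb [:lcoeff f k:] * ddx ^ nat (k + int N)"
      by (simp only: mult.assoc)
  qed
  also have "\<dots> = (\<Sum>j\<in>(\<lambda>k. nat (k + int N)) ` lsupp f. emb [:lcoeff f (int j - int N):] * ddx ^ j)"
  proof (subst sum.reindex)
    show "inj_on (\<lambda>k. nat (k + int N)) (lsupp f)"
    proof (rule inj_onI)
      fix k l assume "k \<in> lsupp f" "l \<in> lsupp f" "nat (k + int N) = nat (l + int N)"
      then show "k = l" using N[of k] N[of l] by linarith
    qed
  qed (use N in \<open>auto intro!: sum.cong\<close>)
  finally have eq: "(\<Sum>j\<in>(\<lambda>k. nat (k + int N)) ` lsupp f. emb [:lcoeff f (int j - int N):] * ddx ^ j) = 0"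
    by simp
  show "lcoeff f k = lcoeff 0 k"
  proof (cases "k \<in> lsupp f")
    case True
    then have "[:lcoeff f (int (nat (k + int N)) - int N):] = 0"
      by (intro emb_ddx_independent[OF eq]) auto
    with N[OF True] show ?thesis by simp
  qed (simp add: in_lsupp_iff)
qed

lemma dd_power_z:
  "dd ^ n * dconst (lmonom 1 1) - dconst (lmonom 1 1) * dd ^ n = of_nat n * dd ^ (n - 1)"
proof (induction n)
  case (Suc n)
  have z: "dd * dconst (lmonom 1 1) = dconst (lmonom 1 1) * dd + 1"
    by (simp add: dd_mult_dconst der_lmonom lmonom_1)
  have "dd ^ Suc n * dconst (lmonom 1 1) = dd ^ n * (dd * dconst (lmonom 1 1))"
    by (simp only: power_Suc2 mult.assoc)
  also have "\<dots> = dd ^ n * dconst (lmonom 1 1) * dd + dd ^ n"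
    by (simp add: z distrib_left mult.assoc)
  finally have "dd ^ Suc n * dconst (lmonom 1 1) - dconst (lmonom 1 1) * dd ^ Suc n
      = (dd ^ n * dconst (lmonom 1 1) - dconst (lmonom 1 1) * dd ^ n) * dd + dd ^ n"
    by (simp add: power_Suc2 left_diff_distrib mult.assoc del: power_Suc)
  also have "\<dots> = of_nat (Suc n) * dd ^ n"
    unfolding Suc.IH by (cases n) (simp_all add: mult.assoc distrib_right power_commutes)
  finally show ?case by simp
qed simp

lemma gmap_eq_0: "gmap A = 0 \<Longrightarrow> A = 0"
proof (induction "dorder A" arbitrary: A rule: less_induct)
  case less
  let ?z = "dconst (lmonom 1 1) :: laurent diffop"
  show ?case
  proof (cases "dorder A")
    case 0
    then have "A = dconst (dcoeff A 0)" using diffop_eq_sum[of A] by simp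
    with less.prems show ?thesis by (metis dconst_0 gmap_dconst lemb_eq_0)
  next
    case (Suc n)
    define C where "C = A * ?z - ?z * A"
    have "C = (\<Sum>i\<le>Suc n. dconst (dcoeff A i) * (dd ^ i * ?z - ?z * dd ^ i))"
    proof -
      have A: "A = (\<Sum>i\<le>Suc n. dconst (dcoeff A i) * dd ^ i)" using diffop_eq_sum[of A] Suc by simp
      have "dconst (dcoeff A i) * dd ^ i * ?z - ?z * (dconst (dcoeff A i) * dd ^ i)
          = dconst (dcoeff A i) * (dd ^ i * ?z - ?z * dd ^ i)" for i
      proof -
        have "?z * dconst (dcoeff A i) = dconst (dcoeff A i) * ?z"
          by (simp add: mult.commute flip: dconst_mult)
        then have "?z * (dconst (dcoeff A i) * dd ^ i) = dconst (dcoeff A i) * (?z * dd ^ i)"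
          by (simp flip: mult.assoc)
        then show ?thesis by (simp only: right_diff_distrib mult.assoc)
      qed
      then show ?thesis unfolding C_def
        by (subst (1 2) A) (simp only: sum_distrib_left sum_distrib_right flip: sum_subtractf)
    qed
    also have "\<dots> = (\<Sum>i\<le>Suc n. dconst (dcoeff A i * of_nat i) * dd ^ (i - 1))"
    proof (intro sum.cong refl)
      fix i
      have "dconst (of_nat i) = (of_nat i :: laurent diffop)"
        by (induction i) (simp_all add: dconst_add)
      then show "dconst (dcoeff A i) * (dd ^ i * ?z - ?z * dd ^ i)
          = dconst (dcoeff A i * of_nat i) * dd ^ (i - 1)"
        by (simp add: dd_power_z dconst_mult mult.assoc)
    qed
    also have "\<dots> = (\<Sum>i\<le>n. dconst (dcoeff A (Suc i) * of_nat (Suc i)) * dd ^ i)"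
      by (subst sum.atMost_Suc_shift) simp
    finally have C: "C = (\<Sum>i\<le>n. dconst (dcoeff A (Suc i) * of_nat (Suc i)) * dd ^ i)" .
    have dC: "dcoeff C i = (if i \<le> n then dcoeff A (Suc i) * of_nat (Suc i) else 0)" for i
      by (simp add: C dcoeff_sum dcoeff_dconst_dd_power)
    have "dorder C \<le> n"
    proof -
      have "\<forall>i>n. dcoeff C i = 0" by (simp add: dC)
      then show ?thesis by transfer (simp add: degree_le)
    qed
    moreover have "gmap C = 0"
    proof -
      have "gmap C = gmap A * gmap ?z - gmap ?z * gmap A"
        using gmap_add[of "A * ?z" "- (?z * A)"] by (simp add: C_def gmap_minus gmap_mult)
      then show ?thesis using less.prems by simp
    qed
    ultimately have "C = 0" using less.hyps Suc by simp
    then have "dcoeff A (Suc n) * of_nat (Suc n) = 0" using dC[of n] by simp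
    moreover have "(of_nat (Suc n) :: laurent) \<noteq> 0"
    proof -
      have "(of_nat k :: laurent) = lmonom (of_nat k) 0" for k
        by (induction k) (simp_all add: lmonom_1[symmetric] lmonom_add)
      then have "lcoeff (of_nat (Suc n) :: laurent) 0 = of_nat (Suc n)"
        by (simp only: lcoeff_lmonom simp_thms if_True)
      then show ?thesis by (metis lcoeff_0 of_nat_neq_0)
    qed
    ultimately have "dcoeff A (dorder A) = 0" unfolding Suc by simp
    then show ?thesis by transfer simp
  qed
qed

lemma psido_power: "P \<in> psido \<Longrightarrow> P ^ n \<in> psido"
  by (induction n) (use psido.emb[of 1] in \<open>auto intro: psido.mult\<close>)

lemma psido_sum: "(\<And>i. i \<in> S \<Longrightarrow> F i \<in> psido) \<Longrightarrow> sum F S \<in> psido"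
  by (induction S rule: infinite_finite_induct) (use psido.emb[of 0] in \<open>auto intro: psido.add\<close>)

theorem gmap_bij: "bij_betw gmap UNIV psido"
proof -
  have "inj gmap"
  proof (rule injI)
    fix A B assume "gmap A = gmap B"
    then have "gmap (A + - B) = 0" by (simp only: gmap_add gmap_minus add.right_inverse)
    then have "A + - B = 0" by (rule gmap_eq_0)
    then show "A = B" by simp
  qed
  moreover have "gmap A \<in> psido" for A
  proof -
    have "ddx powi k \<in> psido" for k
      by (simp add: power_int_def psido_power psido.ddx psido.inverse_ddx)
    then have "lemb f \<in> psido" for f
      unfolding lemb_def by (intro psido_sum psido.mult psido.emb)
    then show ?thesis
      unfolding gmap_def by (intro psido_sum psido.mult psido_power psido.minus psido.emb)
  qed
  moreover have "P \<in> range gmap" if "P \<in> psido" for P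
    using that
  proof induction
    case (emb p)
    show ?case
    proof (induction p)
      case 0
      show ?case by (metis emb_0 gmap_0 rangeI)
    next
      case (pCons a p)
      then obtain A where "emb p = gmap A" by auto
      moreover have "emb (pCons a p) = emb [:a:] + emb [:0, 1:] * emb p"
        by (simp flip: emb_add emb_mult)
      ultimately have "emb (pCons a p) = gmap (dconst (lmonom a 0) + - dd * A)"
        by (simp only: gmap_add gmap_mult gmap_minus gmap_dd gmap_scalar minus_minus)
      then show ?case by blast
    qed
  next
    case ddx
    show ?case by (metis gmap_z rangeI)
  next
    case inverse_ddx
    show ?case by (metis gmap_z_inverse rangeI)
  qed (auto simp flip: gmap_add gmap_minus gmap_mult)
  ultimately show ?thesis by (auto simp: bij_betw_def)
qed


subsection \<open>The sign relating the two cocycles\<close>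

text \<open>On \<open>(z, z\<^sup>-\<^sup>1)\<close> the two cocycles differ by a sign: \<open>DL - LD\<close> is the projection onto the
  constants, so \<open>\<sigma>\<^sub>0(\<partial>, \<partial>\<^sup>-\<^sup>1) = - tr (DL - LD) = - 1\<close>, while \<open>\<tau>(z, z\<^sup>-\<^sup>1) = Res z\<^sup>-\<^sup>1 = 1\<close>. With the
  normalizations fixed here, \<open>circle_cocycle\<close> can thus only be \<open>- kac_cocycle\<close>.\<close>

lemma kac_cocycle_monom:
  "kac_cocycle (dconst f * dd ^ m) (dconst h * dd ^ n) =
    fact m * fact n / fact (m + n + 1) * residue0 ((der ^^ (n + 1)) f * (der ^^ m) h)"
proof -
  have der0: "(der ^^ k) 0 = (0 :: laurent)" for k by (induction k) auto
  have order: "dorder (dconst f * dd ^ m) = (if f = 0 then 0 else m)" for f :: laurent and m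
    by (simp add: dorder.rep_eq diffop_poly_dconst_dd_power degree_monom_eq)
  let ?t = "\<lambda>i j. fact i * fact j / fact (i + j + 1)
    * residue0 ((der ^^ (j + 1)) (dcoeff (dconst f * dd ^ m) i) * (der ^^ i) (dcoeff (dconst h * dd ^ n) j))"
  have r0: "residue0 0 = 0" by (simp add: residue0_def)
  have "kac_cocycle (dconst f * dd ^ m) (dconst h * dd ^ n) = (\<Sum>i\<le>m. \<Sum>j\<le>n. ?t i j)"
  proof (cases "f = 0 \<or> h = 0")
    case True
    then have "?t i j = 0" for i j
      by (elim disjE) (simp_all add: der0 r0 del: funpow.simps)
    then show ?thesis unfolding kac_cocycle_def by (simp only: sum.neutral_const)
  qed (simp add: kac_cocycle_def order)
  also have "\<dots> = (\<Sum>i\<le>m. \<Sum>j\<le>n. if j = n then if i = m then ?t i j else 0 else 0)"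
    by (intro sum.cong refl) (simp add: dcoeff_dconst_dd_power der0 r0 del: funpow.simps)
  also have "\<dots> = ?t m n" by simp
  finally show ?thesis by (simp add: dcoeff_dconst_dd_power del: funpow.simps)
qed

lemma kac_cocycle_z_inverse: "kac_cocycle (dconst (lmonom 1 1)) (dconst (lmonom 1 (- 1))) = 1"
  using kac_cocycle_monom[of "lmonom 1 1" 0 "lmonom 1 (- 1)" 0]
  by (simp add: der_lmonom lmonom_mult residue0_def lcoeff_lmonom)

lemma circle_cocycle_z_inverse:
  "circle_cocycle (dconst (lmonom 1 1)) (dconst (lmonom 1 (- 1))) = - 1"
proof -
  have d: "alpha0 ddx = pderiv"
  proof -
    have "ddx = normal_elt 1 (\<lambda>i. if i = 1 then 1 else 0) 0 (\<lambda>_. 0) (\<lambda>_. 0)"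
      by (simp add: normal_elt_def)
    then show ?thesis
      by (rule ssubst[where P = "\<lambda>P. alpha0 P = _"]) (auto simp: alpha0_normal_elt normal_op_def fun_eq_iff)
  qed
  have i: "alpha0 (inverse ddx) = integ"
  proof -
    have "inverse ddx = normal_elt 0 (\<lambda>_. 0) 1 (\<lambda>_. 1) (\<lambda>_. 1)" by (simp add: normal_elt_def)
    then show ?thesis
      by (rule ssubst[where P = "\<lambda>P. alpha0 P = _"]) (auto simp: alpha0_normal_elt normal_op_def fun_eq_iff)
  qed
  have z: "alpha0 0 = (\<lambda>_. 0)"
  proof -
    have "0 = normal_elt 0 (\<lambda>_. 0) 0 (\<lambda>_. 0) (\<lambda>_. 0)" by (simp add: normal_elt_def)
    then show ?thesis
      by (rule ssubst[where P = "\<lambda>P. alpha0 P = _"]) (auto simp: alpha0_normal_elt normal_op_def fun_eq_iff)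
  qed
  have one: "{..<1 :: nat} = {0}" by auto
  have "finite_rank_rep (\<lambda>p. alpha0 (ddx * inverse ddx - inverse ddx * ddx) p
      - (alpha0 ddx (alpha0 (inverse ddx) p) - alpha0 (inverse ddx) (alpha0 ddx p)))
      1 (\<lambda>_ p. - coeff p 0) (\<lambda>_. 1)"
    unfolding finite_rank_rep_def
  proof (intro conjI allI impI)
    show "Vector_Spaces.linear smult (*) (\<lambda>p. - coeff p 0 :: complex)"
      by unfold_locales (auto simp: algebra_simps smult_add_right smult_add_left)
    fix p
    have "- (pderiv (integ p) - integ (pderiv p)) = smult (- coeff p 0) 1"
    proof (rule poly_eqI)
      fix n
      have "1 + of_nat k \<noteq> (0 :: complex)" for k by (metis of_nat_Suc of_nat_neq_0)
      then show "coeff (- (pderiv (integ p) - integ (pderiv p))) n = coeff (smult (- coeff p 0) 1) n"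
        by (cases n) (simp_all add: coeff_pderiv coeff_integ coeff_pCons del: of_nat_Suc)
    qed
    then show "alpha0 (ddx * inverse ddx - inverse ddx * ddx) p
        - (alpha0 ddx (alpha0 (inverse ddx) p) - alpha0 (inverse ddx) (alpha0 ddx p))
        = (\<Sum>i<1::nat. smult (- coeff p 0) 1)"
      by (simp add: d i z one del: sum_constant)
  qed
  from fr_trace_eq[OF this] show ?thesis
    by (simp add: circle_cocycle_def calkin_cocycle_def gmap_z gmap_z_inverse one del: sum_constant)
qed

end

theory Submission
  imports Defs
begin

text \<open>Differential operators on the circle act on Laurent polynomials, and the subspace
  \<open>\<complex>[z]\<close> is invariant under \<open>\<partial>/\<partial>z\<close> and under multiplication by \<open>z\<close>. The formal Laplace transform
  \<open>x\<^sup>i \<mapsto> i! z\<^sup>-\<^sup>i\<^sup>-\<^sup>1\<close> identifies \<open>\<complex>[x]\<close> with the complement \<open>z\<^sup>-\<^sup>1\<complex>[z\<^sup>-\<^sup>1]\<close>, and with the quotient by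
  \<open>\<complex>[z]\<close>; it turns \<open>D\<close> into multiplication by \<open>z\<close>, multiplication by \<open>- x\<close> into \<open>\<partial>/\<partial>z\<close>, and \<open>L\<close> into
  multiplication by \<open>z\<^sup>-\<^sup>1\<close>. Hence \<open>\<alpha>\<^sub>0(g(A))\<close> is the compression of the action of \<open>A\<close> to this
  complement: \<open>\<alpha>\<^sub>0(g(A)) = \<pi> A \<iota>\<close> with \<open>\<iota>\<close> the Laplace transform (\<open>laplace\<close>) and \<open>\<pi>\<close> its left
  inverse killing \<open>\<complex>[z]\<close>, the formal Borel transform (\<open>borel\<close>). This is \<open>alpha0_gmap\<close>.

  The action is multiplicative, so the failure of \<open>\<alpha>\<^sub>0\<close> to be multiplicative comes from the
  projection alone:
  \<open>\<alpha>\<^sub>0([P, Q]) - [\<alpha>\<^sub>0(P), \<alpha>\<^sub>0(Q)] = \<pi> A (1 - \<iota>\<pi>) B \<iota> - \<pi> B (1 - \<iota>\<pi>) A \<iota>\<close> for \<open>P = g(A)\<close>, \<open>Q = g(B)\<close>.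
  Since \<open>1 - \<iota>\<pi>\<close> projects onto \<open>\<complex>[z]\<close> and \<open>A\<close> maps \<open>z\<^sup>j\<close> into \<open>\<complex>[z]\<close> for large \<open>j\<close>, both operators have
  finite rank; by cyclicity the trace of the first is the trace of \<open>B \<iota>\<pi> A\<close> on
  \<open>\<complex>[z]\<close>, here called \<open>corner_trace\<close> (\<open>circle_cocycle_eq_corner_trace\<close>).

  The rest is bilinear, so it suffices to take \<open>A = z\<^sup>k\<partial>\<^sup>m\<close> and \<open>B = z\<^sup>l\<partial>\<^sup>n\<close>. Both sides vanish unless
  \<open>k + l = m + n\<close>. By antisymmetry one may assume that \<open>a = m - k\<close> is nonnegative; then one of the two
  corner traces is zero and the other is \<open>m! n! \<Sum>\<^sub>j C(j, m) C(j - a, n)\<close>, summed over \<open>0 \<le> j < a\<close>. A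
  Vandermonde convolution evaluates the sum as \<open>(-1)\<^sup>n C(a + n, m + n + 1)\<close>, and this is what the
  residue in the Kac cocycle gives, with the opposite sign.\<close>

section \<open>The action on Laurent polynomials\<close>

text \<open>Modulo the left ideal generated by \<open>\<partial>\<close>, an operator is its constant term, and left
  multiplication by \<open>\<partial>\<close> becomes the derivation. So the constant term of a product depends
  on the right factor only through the constant term of that factor.\<close>

lemma coeff_0_dshift_funpow: "coeff ((dshift ^^ i) q) 0 = (der ^^ i) (coeff q 0)"
  by (induction i) (simp_all add: coeff_dshift)

lemma dcoeff_0_mult: "dcoeff (A * B) 0 = (\<Sum>i\<le>dorder A. dcoeff A i * (der ^^ i) (dcoeff B 0))"
  by transfer (simp add: smul_def coeff_sum coeff_0_dshift_funpow)

text \<open>The constant term of \<open>A \<circ> f\<close> is \<open>A\<close> applied to \<open>f\<close>. This form makes additivity immediate; the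
  familiar formula is \<open>act_eq_sum\<close>.\<close>

definition act :: "'a::differential_ring diffop \<Rightarrow> 'a \<Rightarrow> 'a"
  where "act A f = dcoeff (A * dconst f) 0"

lemma dcoeff_dconst_0 [simp]: "dcoeff (dconst f) 0 = f"
  by transfer simp

lemma act_eq_sum: "act A f = (\<Sum>i\<le>dorder A. dcoeff A i * (der ^^ i) f)"
  by (simp add: act_def dcoeff_0_mult)

lemma act_mult: "act (A * B) f = act A (act B f)"
proof -
  have "act (A * B) f = dcoeff (A * (B * dconst f)) 0"
    by (simp add: act_def mult.assoc)
  also have "\<dots> = act A (act B f)"
    by (subst dcoeff_0_mult) (simp add: act_eq_sum[of A] act_def[of B])
  finally show ?thesis .
qed

lemma act_add_left: "act (A + B) f = act A f + act B f"
  by (simp add: act_def distrib_right dcoeff_add)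

lemma act_0_left [simp]: "act 0 f = 0"
  by (simp add: act_def)

lemma act_add: "act A (f + g) = act A f + act A g"
  by (simp add: act_def dconst_add distrib_left dcoeff_add)

lemma act_0 [simp]: "act A 0 = 0"
  by (simp add: act_def)

lemma act_minus_left: "act (- A) f = - act A f"
  using act_add_left[of A "- A" f] by (simp add: eq_neg_iff_add_eq_0 add.commute)

lemma act_diff_left: "act (A - B) f = act A f - act B f"
  using act_add_left[of A "- B" f] by (simp add: act_minus_left)

lemma act_minus: "act A (- f) = - act A f"
  using act_add[of A f "- f"] by (simp add: eq_neg_iff_add_eq_0 add.commute)

lemma act_diff: "act A (f - g) = act A f - act A g"
  using act_add[of A f "- g"] by (simp add: act_minus)

lemma act_dconst: "act (dconst g) f = g * f"
  by (simp add: act_def flip: dconst_mult)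

lemma act_dd: "act dd f = der f"
  using dcoeff_dconst_dd_power[of f 1 0]
  by (simp add: act_def dd_mult_dconst dcoeff_add)

lemma act_dd_power: "act (dd ^ m) f = (der ^^ m) f"
  by (induction m) (simp_all add: act_mult act_dd act_dconst[of 1, simplified])

lemma act_constant_mult:
  assumes "der c = 0"
  shows "act A (c * f) = c * act A f"
proof -
  have "(der ^^ i) (c * f) = c * (der ^^ i) f" for i
    by (induction i) (simp_all add: der_mult assms)
  then show ?thesis by (simp add: act_eq_sum sum_distrib_left mult.left_commute)
qed

lemma lcoeff_lmonom_mult: "lcoeff (lmonom c n * f) k = c * lcoeff f (k - n)"
  by (induction f rule: laurent_induct)
    (auto simp: distrib_left lmonom_mult lcoeff_lmonom)

lemma lcoeff_minus [simp]: "lcoeff (- f) k = - lcoeff f k"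
  using lcoeff_add[of f "- f" k] by (simp add: eq_neg_iff_add_eq_0 add.commute del: lcoeff_add)

lemma lcoeff_diff [simp]: "lcoeff (f - g) k = lcoeff f k - lcoeff g k"
  using lcoeff_add[of f "- g" k] by simp

lemma act_scalar: "act A (lmonom c 0 * f) = lmonom c 0 * act A f"
  by (rule act_constant_mult) (simp add: der_lmonom)

lemma diffop_induct [case_names zero monom add]:
  fixes A :: "laurent diffop"
  assumes zero: "P 0"
    and monom: "\<And>c k m. P (dconst (lmonom c k) * dd ^ m)"
    and add: "\<And>A B. P A \<Longrightarrow> P B \<Longrightarrow> P (A + B)"
  shows "P A"
proof -
  have f: "P (dconst f * dd ^ m)" for f m
    by (induction f rule: laurent_induct) (simp_all add: zero monom add dconst_add distrib_right)
  have "P (\<Sum>i\<in>I. dconst (dcoeff A i) * dd ^ i)" for I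
    by (induction I rule: infinite_finite_induct) (auto simp: zero f add)
  then show ?thesis by (subst diffop_eq_sum)
qed

section \<open>The Laplace and Borel transforms\<close>

definition laplace :: "complex poly \<Rightarrow> laurent"
  where "laplace p = (\<Sum>i\<le>degree p. lmonom (fact i * coeff p i) (- 1 - int i))"

definition borel :: "laurent \<Rightarrow> complex poly"
  where "borel f = (\<Sum>k\<in>{k \<in> lsupp f. k < 0}.
    monom (lcoeff f k / fact (nat (- 1 - k))) (nat (- 1 - k)))"

lemma lcoeff_laplace:
  "lcoeff (laplace p) k = (if k < 0 then fact (nat (- 1 - k)) * coeff p (nat (- 1 - k)) else 0)"
proof (cases "k < 0")
  case True
  have "lcoeff (laplace p) k
      = (\<Sum>i\<le>degree p. if i = nat (- 1 - k) then fact i * coeff p i else 0)"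
    unfolding laplace_def lcoeff_sum lcoeff_lmonom by (intro sum.cong refl) (use True in auto)
  then show ?thesis using True by (simp add: coeff_eq_0)
next
  case False
  then have "lcoeff (laplace p) k = (\<Sum>i\<le>degree p. 0)"
    unfolding laplace_def lcoeff_sum lcoeff_lmonom by (intro sum.cong refl) auto
  then show ?thesis using False by simp
qed

lemma coeff_borel: "coeff (borel f) i = lcoeff f (- 1 - int i) / fact i"
proof -
  have "coeff (borel f) i = (\<Sum>k\<in>{k \<in> lsupp f. k < 0}.
      if k = - 1 - int i then lcoeff f (- 1 - int i) / fact i else 0)"
    unfolding borel_def coeff_sum by (intro sum.cong refl) auto
  also have "\<dots> = (if - 1 - int i \<in> {k \<in> lsupp f. k < 0} then lcoeff f (- 1 - int i) / fact i else 0)"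
    by (rule sum.delta) simp
  finally show ?thesis by (simp add: in_lsupp_iff)
qed

lemma borel_add: "borel (f + g) = borel f + borel g"
  by (rule poly_eqI) (simp add: coeff_borel add_divide_distrib)

lemma borel_diff: "borel (f - g) = borel f - borel g"
  by (rule poly_eqI) (simp add: coeff_borel diff_divide_distrib)

lemma borel_0 [simp]: "borel 0 = 0"
  by (rule poly_eqI) (simp add: coeff_borel)

lemma borel_scalar: "borel (lmonom c 0 * f) = smult c (borel f)"
  by (rule poly_eqI) (simp add: coeff_borel lcoeff_lmonom_mult)

lemma laplace_add: "laplace (p + q) = laplace p + laplace q"
  by (rule laurent_eqI) (simp add: lcoeff_laplace distrib_left)

lemma laplace_0 [simp]: "laplace 0 = 0"
  by (rule laurent_eqI) (simp add: lcoeff_laplace)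

lemma laplace_smult: "laplace (smult c p) = lmonom c 0 * laplace p"
  by (rule laurent_eqI) (simp add: lcoeff_laplace lcoeff_lmonom_mult)

lemma borel_laplace [simp]: "borel (laplace p) = p"
  by (rule poly_eqI) (simp add: coeff_borel lcoeff_laplace)

text \<open>The composite \<open>\<iota>\<pi>\<close> is the projection onto \<open>z\<^sup>-\<^sup>1\<complex>[z\<^sup>-\<^sup>1]\<close> along \<open>\<complex>[z]\<close>.\<close>

lemma lcoeff_laplace_borel: "lcoeff (laplace (borel f)) k = (if k < 0 then lcoeff f k else 0)"
  by (simp add: lcoeff_laplace coeff_borel)

lemma laplace_borel_lmonom: "laplace (borel (lmonom c k)) = (if k < 0 then lmonom c k else 0)"
  by (rule laurent_eqI) (simp add: lcoeff_laplace_borel lcoeff_lmonom)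

lemma borel_lmonom_nonneg: "k \<ge> 0 \<Longrightarrow> borel (lmonom c k) = 0"
  using borel_laplace[of "borel (lmonom c k)"] by (simp add: laplace_borel_lmonom del: borel_laplace)

lemma Suc_mult_divide_fact: "of_nat (Suc i) * (a / fact (Suc i)) = (a :: complex) / fact i"
  by (simp add: fact_Suc del: of_nat_Suc)

lemma borel_z: "borel (lmonom 1 1 * f) = pderiv (borel f)"
proof (rule poly_eqI)
  fix i
  have "- 1 - int i - 1 = - 1 - int (Suc i)" by simp
  then show "coeff (borel (lmonom 1 1 * f)) i = coeff (pderiv (borel f)) i"
    by (simp only: coeff_borel coeff_pderiv lcoeff_lmonom_mult mult_1_left
        Suc_mult_divide_fact)
qed

lemma borel_der: "borel (der f) = [:0, - 1:] * borel f"
proof (rule poly_eqI)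
  fix i
  show "coeff (borel (der f)) i = coeff ([:0, - 1:] * borel f) i"
  proof (cases i)
    case (Suc j)
    have "- 1 - int i + 1 = - int (Suc j)" "- int (Suc j) = - 1 - int j" using Suc by auto
    then have "lcoeff (der f) (- 1 - int i) = - (of_nat (Suc j) * lcoeff f (- 1 - int j))"
      unfolding lcoeff_der by (metis mult_minus_left of_int_minus of_int_of_nat_eq)
    then show ?thesis
      using Suc Suc_mult_divide_fact[of j "lcoeff f (- 1 - int j)"]
      by (simp add: coeff_borel del: of_nat_Suc fact_Suc)
  qed (simp add: coeff_borel lcoeff_der)
qed

lemma der_laplace: "der (laplace p) = laplace ([:0, - 1:] * p)"
proof (rule laurent_eqI)
  fix k
  show "lcoeff (der (laplace p)) k = lcoeff (laplace ([:0, - 1:] * p)) k"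
  proof (cases "k < - 1")
    case True
    define j where "j = nat (- 2 - k)"
    have k: "k = - 2 - int j" using True by (simp add: j_def)
    have "nat (1 + int j) = Suc j" by simp
    then show ?thesis unfolding k by (simp add: lcoeff_der lcoeff_laplace algebra_simps)
  next
    case False
    then have "k = - 1 \<or> k \<ge> 0" by auto
    then show ?thesis by (auto simp: lcoeff_der lcoeff_laplace)
  qed
qed

lemma borel_z_inverse_laplace: "borel (lmonom 1 (- 1) * laplace p) = integ p"
proof (rule poly_eqI)
  fix i
  show "coeff (borel (lmonom 1 (- 1) * laplace p)) i = coeff (integ p) i"
    by (cases i) (simp_all add: coeff_borel lcoeff_lmonom_mult lcoeff_laplace coeff_integ)
qed

section \<open>The map \<open>\<alpha>\<^sub>0\<close> as a compression\<close>

text \<open>The graph of \<open>\<alpha>\<^sub>0\<close>, generated term by term. Its closure properties follow by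
  checking single terms, where \<open>normal_elt\<close> would need an index manipulation each time.\<close>

inductive realized_by :: "pdo \<Rightarrow> (complex poly \<Rightarrow> complex poly) \<Rightarrow> bool" where
  diff: "realized_by (emb a * ddx ^ i) (\<lambda>p. a * (pderiv ^^ i) p)"
| int: "realized_by (emb b * inverse ddx * emb c) (\<lambda>p. b * integ (c * p))"
| add: "realized_by P S \<Longrightarrow> realized_by Q T \<Longrightarrow> realized_by (P + Q) (\<lambda>p. S p + T p)"

lemma sum_concat:
  fixes f g :: "nat \<Rightarrow> 'b::comm_monoid_add"
  shows "(\<Sum>j=1..m. f j) + (\<Sum>j=1..m'. g j) = (\<Sum>j=1..m + m'. if j \<le> m then f j else g (j - m))"
proof (induction m')
  case (Suc m')
  then show ?case by (simp add: add.assoc[symmetric])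
qed simp

lemma normal_elt_add:
  assumes "a'' = (\<lambda>i. (if i \<le> n then a i else 0) + (if i \<le> n' then a' i else 0))"
    and "b'' = (\<lambda>j. if j \<le> m then b j else b' (j - m))"
    and "c'' = (\<lambda>j. if j \<le> m then c j else c' (j - m))"
  shows "normal_elt n a m b c + normal_elt n' a' m' b' c' = normal_elt (n + n') a'' (m + m') b'' c''"
    and "normal_op n a m b c p + normal_op n' a' m' b' c' p = normal_op (n + n') a'' (m + m') b'' c'' p"
proof -
  have ext: "(\<Sum>i=0..n. f i) = (\<Sum>i=0..n + n'. if i \<le> n then f i else 0)"
    "(\<Sum>i=0..n'. f i) = (\<Sum>i=0..n + n'. if i \<le> n' then f i else 0)" for f :: "nat \<Rightarrow> 'z::comm_monoid_add"
    by (rule sum.mono_neutral_cong_left; auto)+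
  show "normal_elt n a m b c + normal_elt n' a' m' b' c' = normal_elt (n + n') a'' (m + m') b'' c''"
  proof -
    have d: "(\<Sum>i=0..n. emb (a i) * ddx ^ i) + (\<Sum>i=0..n'. emb (a' i) * ddx ^ i)
        = (\<Sum>i=0..n + n'. emb (a'' i) * ddx ^ i)"
      unfolding ext assms(1) sum.distrib[symmetric]
      by (intro sum.cong refl) (auto simp: emb_add distrib_right)
    have i: "(\<Sum>j=1..m. emb (b j) * inverse ddx * emb (c j))
        + (\<Sum>j=1..m'. emb (b' j) * inverse ddx * emb (c' j))
        = (\<Sum>j=1..m + m'. emb (b'' j) * inverse ddx * emb (c'' j))"
      unfolding sum_concat assms(2,3) by (intro sum.cong refl) auto
    show ?thesis unfolding normal_elt_def d[symmetric] i[symmetric] by (simp only: add_ac)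
  qed
  show "normal_op n a m b c p + normal_op n' a' m' b' c' p = normal_op (n + n') a'' (m + m') b'' c'' p"
  proof -
    have d: "(\<Sum>i=0..n. a i * (pderiv ^^ i) p) + (\<Sum>i=0..n'. a' i * (pderiv ^^ i) p)
        = (\<Sum>i=0..n + n'. a'' i * (pderiv ^^ i) p)"
      unfolding ext assms(1) sum.distrib[symmetric]
      by (intro sum.cong refl) (auto simp: distrib_right)
    have i: "(\<Sum>j=1..m. b j * integ (c j * p)) + (\<Sum>j=1..m'. b' j * integ (c' j * p))
        = (\<Sum>j=1..m + m'. b'' j * integ (c'' j * p))"
      unfolding sum_concat assms(2,3) by (intro sum.cong refl) auto
    show ?thesis unfolding normal_op_def d[symmetric] i[symmetric] by (simp only: add_ac)
  qed
qed

lemma alpha0_realized: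
  assumes "realized_by P T"
  shows "alpha0 P = T"
proof -
  have "\<exists>n a m b c. P = normal_elt n a m b c \<and> T = normal_op n a m b c"
    using assms
  proof induction
    case (diff a i)
    have "emb a * ddx ^ i = normal_elt i ((\<lambda>_. 0)(i := a)) 0 (\<lambda>_. 0) (\<lambda>_. 0)"
      unfolding normal_elt_def by (subst sum.remove[of _ i]) auto
    moreover have "(\<lambda>p. a * (pderiv ^^ i) p) = normal_op i ((\<lambda>_. 0)(i := a)) 0 (\<lambda>_. 0) (\<lambda>_. 0)"
      unfolding normal_op_def by (intro ext, subst sum.remove[of _ i]) auto
    ultimately show ?case by blast
  next
    case (int b c)
    have "emb b * inverse ddx * emb c = normal_elt 0 (\<lambda>_. 0) 1 (\<lambda>_. b) (\<lambda>_. c)"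
      by (simp add: normal_elt_def)
    moreover have "(\<lambda>p. b * integ (c * p)) = normal_op 0 (\<lambda>_. 0) 1 (\<lambda>_. b) (\<lambda>_. c)"
      by (simp add: normal_op_def fun_eq_iff)
    ultimately show ?case by blast
  next
    case (add P S Q T)
    then obtain n a m b c n' a' m' b' c' where
      P: "P = normal_elt n a m b c" "S = normal_op n a m b c" and
      Q: "Q = normal_elt n' a' m' b' c'" "T = normal_op n' a' m' b' c'"
      by blast
    show ?case unfolding P Q
      by (intro exI conjI, rule normal_elt_add(1)[OF refl refl refl], intro ext,
        rule normal_elt_add(2)[OF refl refl refl])
  qed
  then show ?thesis using alpha0_normal_elt by metis
qed

text \<open>\<open>\<alpha>\<^sub>0\<close> is not multiplicative, but it commutes with multiplication by polynomials on the left
  and, by the Leibniz rule, by \<open>x\<close> on the right (\<open>realized_by_mult_right_xx\<close>).\<close>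

lemma realized_by_mult_left: "realized_by P T \<Longrightarrow> realized_by (emb q * P) (\<lambda>p. q * T p)"
proof (induction rule: realized_by.induct)
  case (diff a i)
  show ?case using realized_by.diff[of "q * a" i] by (simp add: emb_mult mult.assoc)
next
  case (int b c)
  show ?case using realized_by.int[of "q * b" c] by (simp add: emb_mult mult.assoc)
next
  case (add P S Q T)
  then show ?case using realized_by.add by (simp add: distrib_left)
qed

lemma pderiv_funpow_xx: "(pderiv ^^ i) ([:0, 1:] * p)
    = [:0, 1:] * (pderiv ^^ i) p + of_nat i * (pderiv ^^ (i - 1)) (p :: complex poly)"
proof (induction i)
  case (Suc i)
  define x :: "complex poly" where "x = [:0, 1:]"
  have x: "pderiv (x * q) = x * pderiv q + q" for q
    by (simp add: x_def pderiv_mult pderiv_pCons)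
  have n: "pderiv (of_nat k * q) = of_nat k * pderiv q" for k and q :: "complex poly"
    by (simp add: pderiv_mult)
  have "(pderiv ^^ Suc i) (x * p) = pderiv (x * (pderiv ^^ i) p + of_nat i * (pderiv ^^ (i - 1)) p)"
    using Suc.IH by (simp add: x_def)
  also have "\<dots> = x * (pderiv ^^ Suc i) p + of_nat (Suc i) * (pderiv ^^ i) p"
  proof (cases i)
    case (Suc j)
    have "x * (pderiv ^^ Suc i) p + (pderiv ^^ i) p + of_nat i * pderiv ((pderiv ^^ (i - 1)) p)
        = x * (pderiv ^^ Suc i) p + of_nat (Suc i) * (pderiv ^^ i) p"
      by (simp add: Suc distrib_right)
    then show ?thesis by (simp add: pderiv_add x n)
  qed (simp add: x)
  finally show ?case by (simp only: x_def diff_Suc_1)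
qed simp

lemma realized_by_mult_right_xx: "realized_by P T \<Longrightarrow> realized_by (P * xx) (\<lambda>p. T ([:0, 1:] * p))"
proof (induction rule: realized_by.induct)
  case (diff a i)
  have "ddx ^ i * xx = xx * ddx ^ i + of_nat i * ddx ^ (i - 1)"
  proof (cases i)
    case (Suc j)
    then have "int i - 1 = int j" by simp
    then have "ddx ^ i * xx - xx * ddx ^ i = of_nat i * ddx ^ j"
      using ddx_powi_xx[of "int i"] by (simp only: power_int_of_nat of_int_of_nat_eq)
    then show ?thesis using Suc by (simp add: algebra_simps)
  qed simp
  then have "emb a * ddx ^ i * xx
      = emb (a * [:0, 1:]) * ddx ^ i + emb (a * of_nat i) * ddx ^ (i - 1)"
    by (simp only: emb_mult emb_of_nat distrib_left mult.assoc)
  moreover have "a * (pderiv ^^ i) ([:0, 1:] * p)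
      = (a * [:0, 1:]) * (pderiv ^^ i) p + (a * of_nat i) * (pderiv ^^ (i - 1)) p" for p
    by (simp only: pderiv_funpow_xx distrib_left mult.assoc)
  ultimately show ?case
    using realized_by.add[OF realized_by.diff realized_by.diff] by (simp only:)
next
  case (int b c)
  show ?case using realized_by.int[of b "c * [:0, 1:]"] by (simp only: emb_mult mult.assoc)
next
  case (add P S Q T)
  then show ?case using realized_by.add by (simp only: distrib_right)
qed

text \<open>The operators for which \<open>\<alpha>\<^sub>0(g(A)) = \<pi> A \<iota>\<close>. They are closed under multiplication by \<open>\<partial>/\<partial>z\<close> on both
  sides: \<open>\<partial>/\<partial>z\<close> preserves both \<open>\<complex>[z]\<close> and \<open>z\<^sup>-\<^sup>1\<complex>[z\<^sup>-\<^sup>1]\<close>, so \<open>\<iota>\<close> and \<open>\<pi>\<close> exchange it with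
  multiplication by \<open>- x\<close>, and \<open>\<alpha>\<^sub>0\<close> respects the latter on both sides.\<close>

definition compressed :: "laurent diffop \<Rightarrow> bool"
  where "compressed A \<longleftrightarrow> realized_by (gmap A) (\<lambda>p. borel (act A (laplace p)))"

lemma compressed_add: "compressed A \<Longrightarrow> compressed B \<Longrightarrow> compressed (A + B)"
  unfolding compressed_def gmap_add act_add_left borel_add by (rule realized_by.add)

lemma compressed_scalar: "compressed A \<Longrightarrow> compressed (dconst (lmonom c 0) * A)"
  unfolding compressed_def gmap_mult gmap_scalar act_mult act_dconst borel_scalar
  using realized_by_mult_left[of "gmap A" _ "[:c:]"] by simp

lemma compressed_minus: "compressed A \<Longrightarrow> compressed (- A)"
proof -
  assume "compressed A"
  then have "compressed (dconst (lmonom (- 1) 0) * A)" by (rule compressed_scalar)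
  moreover have "lmonom (- 1) 0 = - 1" by (rule laurent_eqI) (simp add: lcoeff_lmonom flip: lmonom_1)
  moreover have "dconst (- 1 :: laurent) = - 1"
    using dconst_add[of 1 "- 1 :: laurent"] by (simp add: eq_neg_iff_add_eq_0 add.commute)
  ultimately show ?thesis by simp
qed

lemma gmap_dd_emb: "gmap dd = emb [:0, - 1:]"
  using emb_minus[of "[:0, 1:]"] by (simp add: gmap_dd)

lemma compressed_dd_mult: "compressed A \<Longrightarrow> compressed (dd * A)"
  unfolding compressed_def gmap_mult gmap_dd_emb act_mult act_dd borel_der
  by (rule realized_by_mult_left)

lemma compressed_mult_dd: "compressed A \<Longrightarrow> compressed (A * dd)"
proof -
  assume "compressed A"
  then have "realized_by (gmap A * xx) (\<lambda>p. borel (act A (laplace ([:0, 1:] * p))))"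
    unfolding compressed_def by (rule realized_by_mult_right_xx)
  then have "realized_by (emb [:- 1:] * (gmap A * xx))
      (\<lambda>p. [:- 1:] * borel (act A (laplace ([:0, 1:] * p))))"
    by (rule realized_by_mult_left)
  moreover have "[:- 1:] = - (1 :: complex poly)" by (simp add: one_pCons)
  then have "emb [:- 1:] = - 1" by (simp only: emb_minus emb_1)
  then have "emb [:- 1:] * (gmap A * xx) = gmap (A * dd)"
    by (simp add: gmap_mult gmap_dd)
  moreover have "[:- 1:] * borel (act A (laplace ([:0, 1:] * p))) = borel (act (A * dd) (laplace p))"
    for p
  proof -
    have "[:0, - 1:] * p = smult (- 1) ([:0, 1:] * p)" by simp
    then have "der (laplace p) = lmonom (- 1) 0 * laplace ([:0, 1:] * p)"
      by (simp only: der_laplace laplace_smult)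
    then show ?thesis by (simp add: act_mult act_dd act_scalar borel_scalar)
  qed
  ultimately show ?thesis by (simp add: compressed_def)
qed

lemma compressed_z_power: "compressed (dconst (lmonom 1 (int k)))"
proof -
  have "borel (lmonom 1 (int k) * f) = (pderiv ^^ k) (borel f)" for f
  proof (induction k)
    case (Suc k)
    have "lmonom 1 (int (Suc k)) * f = lmonom 1 1 * (lmonom 1 (int k) * f)"
      by (simp add: lmonom_mult flip: mult.assoc)
    then show ?case using Suc by (simp only: borel_z funpow.simps comp_apply)
  qed (simp add: lmonom_1)
  then show ?thesis
    using realized_by.diff[of 1 k]
    by (simp add: compressed_def gmap_dconst lemb_lmonom act_dconst flip: one_pCons)
qed

text \<open>The commutator \<open>[\<partial>/\<partial>z, z\<^sup>-\<^sup>k\<^sup>-\<^sup>1] = - (k + 1) z\<^sup>-\<^sup>k\<^sup>-\<^sup>2\<close> reduces every negative power of \<open>z\<close> to \<open>z\<^sup>-\<^sup>1\<close>, so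
  no normal form of \<open>\<partial>\<^sup>-\<^sup>k\<close> has to be computed.\<close>

lemma compressed_z_inverse_power: "compressed (dconst (lmonom 1 (- 1 - int k)))"
proof (induction k)
  case 0
  show ?case using realized_by.int[of 1 1]
    by (simp add: compressed_def gmap_z_inverse act_dconst borel_z_inverse_laplace)
next
  case (Suc k)
  let ?Z = "dconst (lmonom 1 (- 1 - int k)) :: laurent diffop"
  let ?c = "1 / of_int (- 1 - int k) :: complex"
  have "dd * ?Z + - (?Z * dd) = dconst (lmonom (of_int (- 1 - int k)) (- 1 - int (Suc k)))"
    by (simp add: dd_mult_dconst der_lmonom)
  moreover have "?c * of_int (- 1 - int k) = 1"
  proof -
    have "- 1 - int k \<noteq> 0" by simp
    then have "of_int (- 1 - int k) \<noteq> (0 :: complex)" by (simp only: of_int_eq_0_iff not_False_eq_True)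
    then show ?thesis by (simp only: divide_self_if if_False times_divide_eq_left mult_1_left)
  qed
  ultimately have "dconst (lmonom ?c 0) * (dd * ?Z + - (?Z * dd))
      = dconst (lmonom 1 (- 1 - int (Suc k)))"
    by (simp only: lmonom_mult add_0 flip: dconst_mult)
  moreover have "compressed (dconst (lmonom ?c 0) * (dd * ?Z + - (?Z * dd)))"
    by (intro compressed_scalar compressed_add compressed_minus compressed_dd_mult
        compressed_mult_dd Suc.IH)
  ultimately show ?case by simp
qed

lemma compressed_dconst: "compressed (dconst (lmonom c k))"
proof -
  have "compressed (dconst (lmonom 1 k))"
  proof (cases "k \<ge> 0")
    case True
    then show ?thesis using compressed_z_power[of "nat k"] by simp
  next
    case False
    then show ?thesis using compressed_z_inverse_power[of "nat (- 1 - k)"] by simp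
  qed
  from compressed_scalar[OF this, of c] show ?thesis by (simp add: lmonom_mult flip: dconst_mult)
qed

text \<open>Starting from the powers of \<open>z\<close>, closure under right multiplication by \<open>\<partial>/\<partial>z\<close> and under sums
  reaches every operator.\<close>

theorem alpha0_gmap: "alpha0 (gmap A) p = borel (act A (laplace p))"
proof -
  have "compressed A"
  proof (induction A rule: diffop_induct)
    case zero
    show ?case using realized_by.diff[of 0 0] by (simp add: compressed_def)
  next
    case (monom c k m)
    show ?case
    proof (induction m arbitrary: c k)
      case 0
      show ?case by (simp add: compressed_dconst)
    next
      case (Suc m)
      then show ?case
        unfolding power_Suc2 by (simp add: compressed_mult_dd flip: mult.assoc)
    qed
  next
    case (add A B)
    then show ?case by (rule compressed_add)
  qed
  then show ?thesis unfolding compressed_def by (simp add: alpha0_realized)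
qed

section \<open>The Calkin cocycle as a corner trace\<close>

text \<open>The trace of \<open>B \<iota>\<pi> A\<close> over the first \<open>M\<close> basis vectors \<open>z\<^sup>j\<close> of \<open>\<complex>[z]\<close>. It no longer depends on \<open>M\<close>
  once \<open>M\<close> is large. Working with a cut-off common to all operators, valid for all large \<open>M\<close>,
  makes the expression bilinear.\<close>

definition corner_trace :: "nat \<Rightarrow> laurent diffop \<Rightarrow> laurent diffop \<Rightarrow> complex"
  where "corner_trace M A B =
    (\<Sum>j<M. lcoeff (act B (laplace (borel (act A (lmonom 1 (int j)))))) (int j))"

lemma act_monom: "act (dconst f * dd ^ m) g = f * (der ^^ m) g"
  by (simp add: act_mult act_dconst act_dd_power)

lemma der_funpow_lmonom:
  "(der ^^ n) (lmonom c k) = lmonom (fact n * (of_int k gchoose n) * c) (k - int n)"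
proof (induction n)
  case (Suc n)
  have "of_int (k - int n) * (fact n * (of_int k gchoose n)) = fact (Suc n) * ((of_int k :: complex) gchoose Suc n)"
    by (simp add: gbinomial_mult_fact algebra_simps del: fact_Suc)
  then have "of_int (k - int n) * (fact n * (of_int k gchoose n) * c)
      = fact (Suc n) * ((of_int k :: complex) gchoose Suc n) * c"
    by (simp only: mult.assoc[symmetric])
  moreover have "k - int n - 1 = k - int (Suc n)" by simp
  ultimately show ?case by (simp only: funpow.simps comp_apply Suc.IH der_lmonom)
qed simp

lemma act_monom_lmonom: "act (dconst (lmonom c k) * dd ^ m) (lmonom d j)
    = lmonom (c * d * fact m * (of_int j gchoose m)) (j + k - int m)"
  by (simp add: act_monom der_funpow_lmonom lmonom_mult algebra_simps)

lemma eventually_borel_act_eq_0: "\<forall>\<^sub>F M in sequentially. \<forall>j\<ge>M. borel (act A (lmonom 1 (int j))) = 0"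
proof (induction A rule: diffop_induct)
  case (monom c k m)
  have "\<forall>\<^sub>F M in sequentially. nat (int m - k) \<le> M" by (rule eventually_ge_at_top)
  then show ?case
  proof (rule eventually_mono)
    fix M assume "nat (int m - k) \<le> M"
    then show "\<forall>j\<ge>M. borel (act (dconst (lmonom c k) * dd ^ m) (lmonom 1 (int j))) = 0"
      by (auto simp: act_monom_lmonom borel_lmonom_nonneg)
  qed
next
  case (add A B)
  then show ?case by eventually_elim (simp add: act_add_left borel_add)
qed simp

text \<open>Expanding \<open>(1 - \<iota>\<pi>) f\<close> in powers of \<open>z\<close> exhibits \<open>\<pi> A (1 - \<iota>\<pi>)\<close> as a finite sum of rank-one maps.\<close>

lemma borel_act_defect:
  assumes "\<forall>j\<ge>M. borel (act A (lmonom 1 (int j))) = 0"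
  shows "borel (act A (f - laplace (borel f)))
    = (\<Sum>j<M. smult (lcoeff f (int j)) (borel (act A (lmonom 1 (int j)))))"
proof (induction f rule: laurent_induct)
  case (add c k f)
  have "borel (act A (lmonom c k - laplace (borel (lmonom c k))))
      = (\<Sum>j<M. smult (lcoeff (lmonom c k) (int j)) (borel (act A (lmonom 1 (int j)))))"
  proof (cases "k < 0")
    case True
    then show ?thesis by (simp add: laplace_borel_lmonom lcoeff_lmonom)
  next
    case False
    then obtain i where k: "k = int i" using nonneg_int_cases[of k] by auto
    have "lmonom c k = lmonom c 0 * lmonom 1 (int i)" by (simp add: lmonom_mult k)
    then have "borel (act A (lmonom c k)) = smult c (borel (act A (lmonom 1 (int i))))"
      by (simp only: act_scalar borel_scalar)
    also have "\<dots> = (\<Sum>j<M. if j = i then smult c (borel (act A (lmonom 1 (int j)))) else 0)"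
      using assms by simp
    also have "\<dots> = (\<Sum>j<M. smult (lcoeff (lmonom c k) (int j)) (borel (act A (lmonom 1 (int j)))))"
      by (intro sum.cong refl) (auto simp: lcoeff_lmonom k)
    finally show ?thesis using False by (simp add: laplace_borel_lmonom)
  qed
  moreover have "lmonom c k + f - laplace (borel (lmonom c k + f))
      = (lmonom c k - laplace (borel (lmonom c k))) + (f - laplace (borel f))"
    by (simp add: borel_add laplace_add)
  ultimately show ?case
    using add.IH by (simp only: act_add borel_add lcoeff_add smult_add_left sum.distrib)
qed simp

lemma sum_lessThan_append:
  fixes f g :: "nat \<Rightarrow> 'b::comm_monoid_add"
  shows "(\<Sum>i<n + n'. if i < n then f i else g (i - n)) = (\<Sum>i<n. f i) + (\<Sum>i<n'. g i)"
  by (induction n') (simp_all add: add.assoc)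

lemma fr_trace_diff:
  assumes S: "finite_rank_rep S n \<phi> v" and T: "finite_rank_rep T n' \<psi> w"
  shows "fr_trace (\<lambda>p. S p - T p) = (\<Sum>i<n. \<phi> i (v i)) - (\<Sum>i<n'. \<psi> i (w i))"
proof -
  define \<chi> where "\<chi> i = (if i < n then \<phi> i else \<psi> (i - n))" for i
  define u where "u i = (if i < n then v i else - w (i - n))" for i
  have lin: "Vector_Spaces.linear smult (*) (\<psi> i)" if "i < n'" for i
    using T that by (simp add: finite_rank_rep_def)
  have "finite_rank_rep (\<lambda>p. S p - T p) (n + n') \<chi> u"
    unfolding finite_rank_rep_def
  proof (intro conjI allI impI)
    fix i assume "i < n + n'"
    then show "Vector_Spaces.linear smult (*) (\<chi> i)"
      using S lin by (simp add: finite_rank_rep_def \<chi>_def)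
  next
    fix p
    have "(\<Sum>i<n + n'. smult (\<chi> i p) (u i))
        = (\<Sum>i<n + n'. if i < n then smult (\<phi> i p) (v i) else smult (\<psi> (i - n) p) (- w (i - n)))"
      by (intro sum.cong refl) (simp add: \<chi>_def u_def)
    also have "\<dots> = (\<Sum>i<n. smult (\<phi> i p) (v i)) + (\<Sum>i<n'. smult (\<psi> i p) (- w i))"
      by (rule sum_lessThan_append[where f = "\<lambda>i. smult (\<phi> i p) (v i)" and g = "\<lambda>i. smult (\<psi> i p) (- w i)"])
    also have "\<dots> = S p - T p"
      using S T by (simp add: finite_rank_rep_def sum_negf)
    finally show "S p - T p = (\<Sum>i<n + n'. smult (\<chi> i p) (u i))" ..
  qed
  then have "fr_trace (\<lambda>p. S p - T p) = (\<Sum>i<n + n'. \<chi> i (u i))" by (rule fr_trace_eq)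
  also have "\<dots> = (\<Sum>i<n + n'. if i < n then \<phi> i (v i) else \<psi> (i - n) (- w (i - n)))"
    by (intro sum.cong refl) (simp add: \<chi>_def u_def)
  also have "\<dots> = (\<Sum>i<n. \<phi> i (v i)) + (\<Sum>i<n'. \<psi> i (- w i))"
    by (rule sum_lessThan_append[where f = "\<lambda>i. \<phi> i (v i)" and g = "\<lambda>i. \<psi> i (- w i)"])
  also have "(\<Sum>i<n'. \<psi> i (- w i)) = - (\<Sum>i<n'. \<psi> i (w i))"
  proof -
    have "\<psi> i (- w i) = - \<psi> i (w i)" if "i < n'" for i
    proof -
      interpret Vector_Spaces.linear smult "(*)" "\<psi> i" by (rule lin[OF that])
      show ?thesis by (rule neg)
    qed
    then show ?thesis by (simp add: sum_negf)
  qed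
  finally show ?thesis by simp
qed

lemma circle_cocycle_eq_corner_trace:
  "\<forall>\<^sub>F M in sequentially. circle_cocycle A B = corner_trace M A B - corner_trace M B A"
  using eventually_borel_act_eq_0[of A] eventually_borel_act_eq_0[of B]
proof eventually_elim
  case (elim M)
  \<comment> \<open>The operator \<open>\<pi> A (1 - \<iota>\<pi>) B \<iota>\<close>.\<close>
  define defect where "defect A B p =
    borel (act A (act B (laplace p) - laplace (borel (act B (laplace p)))))" for A B p
  have rep: "finite_rank_rep (defect A B) M (\<lambda>j p. lcoeff (act B (laplace p)) (int j))
      (\<lambda>j. borel (act A (lmonom 1 (int j))))"
    if "\<forall>j\<ge>M. borel (act A (lmonom 1 (int j))) = 0" for A B
    unfolding finite_rank_rep_def
  proof (intro conjI allI impI)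
    fix i
    show "Vector_Spaces.linear smult (*) (\<lambda>p. lcoeff (act B (laplace p)) (int i))"
      by unfold_locales (simp_all add: laplace_add laplace_smult act_add act_scalar
          lcoeff_lmonom_mult smult_add_right smult_add_left distrib_left distrib_right)
  qed (use borel_act_defect[OF that] in \<open>simp add: defect_def\<close>)
  have "alpha0 (gmap A * gmap B - gmap B * gmap A) p
      - (alpha0 (gmap A) (alpha0 (gmap B) p) - alpha0 (gmap B) (alpha0 (gmap A) p))
      = defect A B p - defect B A p" for p
  proof -
    have "gmap A * gmap B - gmap B * gmap A = gmap (A * B - B * A)"
      using gmap_add[of "A * B" "- (B * A)"] by (simp add: gmap_minus gmap_mult)
    then show ?thesis
      by (simp add: alpha0_gmap defect_def act_mult act_diff_left borel_diff act_diff)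
  qed
  then have "circle_cocycle A B = fr_trace (\<lambda>p. defect A B p - defect B A p)"
    by (simp add: circle_cocycle_def calkin_cocycle_def)
  also have "\<dots> = corner_trace M A B - corner_trace M B A"
    unfolding corner_trace_def using elim by (intro fr_trace_diff rep)
  finally show ?case .
qed

section \<open>The corner trace on monomials\<close>

text \<open>Both sides satisfy Pascal's rule in \<open>N\<close> and \<open>n\<close>; they count the subsets of \<open>{0..N}\<close> with
  \<open>m + n + 1\<close> elements by their element \<open>j\<close> that has \<open>m\<close> smaller ones.\<close>

lemma sum_choose_mult_choose: "(\<Sum>j\<le>N. (j choose m) * ((N - j) choose n)) = (N + 1) choose (m + n + 1)"
proof (induction N arbitrary: n)
  case 0
  show ?case by (cases m; cases n) simp_all
next
  case (Suc N)
  show ?case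
  proof (cases n)
    case 0
    then show ?thesis using sum_choose_upper[of m "Suc N"] by simp
  next
    case (Suc k)
    have "(\<Sum>j\<le>Suc N. (j choose m) * ((Suc N - j) choose Suc k))
        = (\<Sum>j\<le>N. (j choose m) * ((N - j) choose k) + (j choose m) * ((N - j) choose Suc k))"
      by (simp add: Suc_diff_le distrib_left)
    also have "\<dots> = ((N + 1) choose (m + k + 1)) + ((N + 1) choose (m + Suc k + 1))"
      by (simp only: sum.distrib Suc.IH)
    finally show ?thesis using Suc by simp
  qed
qed

text \<open>Negating the upper index turns \<open>C(j - a, n)\<close> into \<open>(-1)\<^sup>n C(a + n - 1 - j, n)\<close>, and the terms with
  \<open>a \<le> j < a + n\<close> that complete the convolution vanish.\<close>

lemma sum_gchoose_mult_gchoose: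
  "(\<Sum>j<a. (of_nat j gchoose m) * ((of_nat j - of_nat a) gchoose n))
    = (- 1) ^ n * ((of_nat (a + n) :: complex) gchoose (m + n + 1))"
proof (cases "a + n")
  case (Suc N)
  have "(\<Sum>j<a. (of_nat j gchoose m) * ((of_nat j - of_nat a :: complex) gchoose n))
      = (\<Sum>j<a. (- 1) ^ n * of_nat ((j choose m) * ((N - j) choose n)))"
  proof (intro sum.cong refl)
    fix j assume "j \<in> {..<a}"
    then have "of_nat n - (of_nat j - of_nat a) - 1 = (of_nat (N - j) :: complex)"
      using Suc by (simp add: of_nat_diff algebra_simps flip: of_nat_add)
    then show "(of_nat j gchoose m) * ((of_nat j - of_nat a) gchoose n)
        = (- 1) ^ n * (of_nat ((j choose m) * ((N - j) choose n)) :: complex)"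
      by (subst gbinomial_negated_upper[of _ n]) (simp add: binomial_gbinomial)
  qed
  also have "\<dots> = (\<Sum>j\<le>N. (- 1) ^ n * of_nat ((j choose m) * ((N - j) choose n)))"
    by (rule sum.mono_neutral_left) (use Suc in \<open>auto simp: binomial_eq_0\<close>)
  also have "\<dots> = (- 1) ^ n * of_nat (\<Sum>j\<le>N. (j choose m) * ((N - j) choose n))"
    by (simp only: of_nat_sum sum_distrib_left)
  finally show ?thesis
    using Suc by (simp only: sum_choose_mult_choose binomial_gbinomial Suc_eq_plus1)
qed simp

text \<open>The left side is the coefficient in the Kac cocycle for \<open>k = m - a\<close>, \<open>l = n + a\<close>. The falling
  factorials of \<open>n + a\<close> of length \<open>m\<close> and, up to sign, of \<open>n + a - m\<close> of length \<open>n + 1\<close> are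
  consecutive and combine into the one of length \<open>m + n + 1\<close>.\<close>

lemma fact_mult_gchoose_product:
  "fact m * fact n / fact (m + n + 1) * ((fact (n + 1) * ((of_nat m - of_nat a) gchoose (n + 1)))
      * (fact m * ((of_nat n + of_nat a) gchoose m)))
    = (- 1) ^ (n + 1) * fact m * fact n * ((of_nat (a + n) :: complex) gchoose (m + n + 1))"
proof -
  let ?x = "of_nat (a + n) :: complex"
  have "(?x gchoose (m + n + 1)) * (of_nat (m + n + 1) gchoose m)
      = (?x gchoose m) * ((?x - of_nat m) gchoose (n + 1))"
    using gbinomial_trinomial_revision[of m "m + n + 1" ?x] by simp
  moreover have "(of_nat (m + n + 1) :: complex) gchoose m = fact (m + n + 1) / (fact m * fact (n + 1))"
    using binomial_fact[of m "m + n + 1", where 'a = complex]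
    by (simp add: binomial_gbinomial)
  ultimately have "(?x gchoose m) * ((?x - of_nat m) gchoose (n + 1))
      = (?x gchoose (m + n + 1)) * (fact (m + n + 1) / (fact m * fact (n + 1)))"
    by (simp only:)
  then have prod: "fact m * fact (n + 1) * ((?x gchoose m) * ((?x - of_nat m) gchoose (n + 1)))
      = fact (m + n + 1) * (?x gchoose (m + n + 1))"
    by (simp add: field_simps del: fact_Suc of_nat_add)
  have neg: "((of_nat m - of_nat a) gchoose (n + 1) :: complex)
      = (- 1) ^ (n + 1) * ((?x - of_nat m) gchoose (n + 1))"
    by (subst gbinomial_negated_upper) (simp add: algebra_simps)
  have x: "of_nat n + of_nat a = ?x" by simp
  have "fact m * fact n / fact (m + n + 1) * ((fact (n + 1) * ((of_nat m - of_nat a) gchoose (n + 1)))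
      * (fact m * ((of_nat n + of_nat a) gchoose m)))
    = (- 1) ^ (n + 1) * fact m * fact n / fact (m + n + 1)
      * (fact m * fact (n + 1) * ((?x gchoose m) * ((?x - of_nat m) gchoose (n + 1))))"
    unfolding neg x by (simp only: mult_ac times_divide_eq_left times_divide_eq_right)
  also have "\<dots> = (- 1) ^ (n + 1) * fact m * fact n * (?x gchoose (m + n + 1))"
    unfolding prod by (simp del: fact_Suc of_nat_add)
  finally show ?thesis .
qed

lemma corner_trace_monom:
  "corner_trace M (dconst (lmonom c k) * dd ^ m) (dconst (lmonom d l) * dd ^ n)
    = (\<Sum>j<M. if int j < int m - k \<and> k + l = int m + int n
        then c * d * fact m * fact n * (of_nat j gchoose m)
          * ((of_nat j - of_int (int m - k)) gchoose n) else 0)"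
  unfolding corner_trace_def
proof (intro sum.cong refl)
  fix j
  show "lcoeff (act (dconst (lmonom d l) * dd ^ n) (laplace (borel
      (act (dconst (lmonom c k) * dd ^ m) (lmonom 1 (int j)))))) (int j)
    = (if int j < int m - k \<and> k + l = int m + int n
        then c * d * fact m * fact n * (of_nat j gchoose m)
          * ((of_nat j - of_int (int m - k)) gchoose n) else 0)"
    by (simp add: act_monom_lmonom laplace_borel_lmonom lcoeff_lmonom algebra_simps)
qed

lemma kac_cocycle_lmonom:
  "kac_cocycle (dconst (lmonom c k) * dd ^ m) (dconst (lmonom d l) * dd ^ n)
    = (if k + l = int m + int n then fact m * fact n / fact (m + n + 1)
        * ((fact (n + 1) * (of_int k gchoose (n + 1))) * (fact m * (of_int l gchoose m))) * (c * d)
       else 0)"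
  by (simp add: kac_cocycle_monom der_funpow_lmonom lmonom_mult residue0_def lcoeff_lmonom
      del: funpow.simps fact_Suc)

text \<open>Antisymmetry is integration by parts: the residue of a derivative is zero.\<close>

lemma kac_cocycle_monom_swap:
  "kac_cocycle (dconst g * dd ^ n) (dconst f * dd ^ m)
    = - kac_cocycle (dconst f * dd ^ m) (dconst g * dd ^ n)"
proof -
  let ?f = "(der ^^ n) f" and ?g = "(der ^^ m) g"
  have "residue0 (der ?f * ?g) + residue0 (der ?g * ?f) = residue0 (der (?f * ?g))"
    by (simp add: der_mult residue0_def mult.commute)
  also have "\<dots> = 0" by (simp add: residue0_def lcoeff_der)
  finally have "residue0 (der ?g * ?f) = - residue0 (der ?f * ?g)"
    by (simp add: eq_neg_iff_add_eq_0 add.commute)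
  then show ?thesis by (simp add: kac_cocycle_monom ac_simps del: fact_Suc)
qed

text \<open>Here \<open>A\<close> lowers degrees by \<open>m - k \<ge> 0\<close> and \<open>B\<close> raises them by the same amount. So \<open>B\<close> preserves \<open>\<complex>[z]\<close>,
  which kills the second trace.\<close>

lemma corner_trace_monom_eq_kac_cocycle:
  fixes k l :: int and m n :: nat
  defines "A \<equiv> \<lambda>c. dconst (lmonom c k) * dd ^ m" and "B \<equiv> \<lambda>d. dconst (lmonom d l) * dd ^ n"
  assumes kl: "k + l = int m + int n" and k: "k \<le> int m" and M: "int M \<ge> int m - k"
  shows "corner_trace M (A c) (B d) = - kac_cocycle (A c) (B d)"
    and "corner_trace M (B d) (A c) = 0"
proof -
  define a where "a = nat (int m - k)"
  have a: "int m - k = int a" "k = int m - int a" "l = int n + int a" "a \<le> M"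
    using k kl M by (auto simp: a_def)
  have "corner_trace M (A c) (B d) = (\<Sum>j<M. if j < a then c * d * fact m * fact n *
      ((of_nat j gchoose m) * ((of_nat j - of_nat a) gchoose n)) else 0)"
    unfolding A_def B_def corner_trace_monom using kl
    by (intro sum.cong refl) (simp add: a(1) mult.assoc)
  also have "\<dots> = (\<Sum>j<a. c * d * fact m * fact n *
      ((of_nat j gchoose m) * ((of_nat j - of_nat a) gchoose n)))"
    by (rule sum.mono_neutral_cong_right) (use a(4) in auto)
  also have "\<dots> = c * d * fact m * fact n * ((- 1) ^ n * (of_nat (a + n) gchoose (m + n + 1)))"
    by (simp only: sum_gchoose_mult_gchoose flip: sum_distrib_left)
  also have "\<dots> = - (((- 1) ^ (n + 1) * fact m * fact n * (of_nat (a + n) gchoose (m + n + 1))) * (c * d))"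
    by simp
  also have "\<dots> = - kac_cocycle (A c) (B d)"
    unfolding fact_mult_gchoose_product[symmetric]
    using kl by (simp add: A_def B_def kac_cocycle_lmonom a del: fact_Suc)
  finally show "corner_trace M (A c) (B d) = - kac_cocycle (A c) (B d)" .
  show "corner_trace M (B d) (A c) = 0"
    unfolding A_def B_def corner_trace_monom by (rule sum.neutral) (use a in auto)
qed

section \<open>Reduction to monomials by bilinearity\<close>

lemma kac_cocycle_altdef:
  assumes "dorder A \<le> M" "dorder B \<le> N"
  shows "kac_cocycle A B = (\<Sum>m\<le>M. \<Sum>n\<le>N. fact m * fact n / fact (m + n + 1)
      * residue0 ((der ^^ (n + 1)) (dcoeff A m) * (der ^^ m) (dcoeff B n)))"
proof -
  have zero: "dcoeff C i = 0" if "dorder C < i" for C :: "laurent diffop" and i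
    using that by transfer (simp add: coeff_eq_0)
  have der0: "(der ^^ i) 0 = (0 :: laurent)" for i by (induction i) auto
  have "(\<Sum>n\<le>dorder B. fact m * fact n / fact (m + n + 1)
      * residue0 ((der ^^ (n + 1)) (dcoeff A m) * (der ^^ m) (dcoeff B n)))
    = (\<Sum>n\<le>N. fact m * fact n / fact (m + n + 1)
      * residue0 ((der ^^ (n + 1)) (dcoeff A m) * (der ^^ m) (dcoeff B n)))" for m
    using assms(2) by (intro sum.mono_neutral_left)
      (auto simp: zero der0 residue0_def simp del: funpow.simps)
  then show ?thesis unfolding kac_cocycle_def
    using assms(1) by (subst sum.mono_neutral_left[of "{..M}" "{..dorder A}"])
      (auto simp: zero der0 residue0_def simp del: funpow.simps)
qed

lemma der_funpow_add: "(der ^^ i) (f + g) = (der ^^ i) f + (der ^^ i) (g :: 'a::differential_ring)"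
  by (induction i) (simp_all add: der_add)

lemma residue0_add: "residue0 (f + g) = residue0 f + residue0 g"
  by (simp add: residue0_def)

lemma kac_cocycle_add_left: "kac_cocycle (A + A') B = kac_cocycle A B + kac_cocycle A' B"
proof -
  define M where "M = max (dorder (A + A')) (max (dorder A) (dorder A'))"
  have "dorder (A + A') \<le> M" "dorder A \<le> M" "dorder A' \<le> M" by (auto simp: M_def)
  then show ?thesis
    by (simp add: kac_cocycle_altdef[of _ M _ "dorder B"] dcoeff_add der_funpow_add residue0_add
        distrib_left distrib_right sum.distrib del: funpow.simps fact_Suc)
qed

lemma kac_cocycle_add_right: "kac_cocycle A (B + B') = kac_cocycle A B + kac_cocycle A B'"
proof -
  define N where "N = max (dorder (B + B')) (max (dorder B) (dorder B'))"
  have "dorder (B + B') \<le> N" "dorder B \<le> N" "dorder B' \<le> N" by (auto simp: N_def)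
  then show ?thesis
    by (simp add: kac_cocycle_altdef[of _ "dorder A" _ N] dcoeff_add der_funpow_add residue0_add
        distrib_left distrib_right sum.distrib del: funpow.simps fact_Suc)
qed

lemma kac_cocycle_0_left [simp]: "kac_cocycle 0 B = 0"
  using kac_cocycle_add_left[of 0 0 B] by simp

lemma kac_cocycle_0_right [simp]: "kac_cocycle A 0 = 0"
  using kac_cocycle_add_right[of A 0 0] by simp

lemma corner_trace_add_left: "corner_trace M (A + A') B = corner_trace M A B + corner_trace M A' B"
  by (simp add: corner_trace_def act_add_left borel_add laplace_add act_add sum.distrib)

lemma corner_trace_add_right: "corner_trace M A (B + B') = corner_trace M A B + corner_trace M A B'"
  by (simp add: corner_trace_def act_add_left sum.distrib)

lemma corner_trace_0 [simp]: "corner_trace M 0 B = 0" "corner_trace M A 0 = 0"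
  by (simp_all add: corner_trace_def)

lemma corner_trace_commutator_eq_kac_cocycle:
  "\<forall>\<^sub>F M in sequentially. corner_trace M A B - corner_trace M B A = - kac_cocycle A B"
proof (induction A rule: diffop_induct)
  case (monom c k m)
  show ?case
  proof (induction B rule: diffop_induct)
    case (monom d l n)
    let ?A = "dconst (lmonom c k) * dd ^ m" and ?B = "dconst (lmonom d l) * dd ^ n"
    have "\<forall>\<^sub>F M in sequentially. nat \<bar>int m - k\<bar> \<le> M" by (rule eventually_ge_at_top)
    then show ?case
    proof (rule eventually_mono)
      fix M assume M: "nat \<bar>int m - k\<bar> \<le> M"
      show "corner_trace M ?A ?B - corner_trace M ?B ?A = - kac_cocycle ?A ?B"
      proof (cases "k + l = int m + int n")
        case False
        then show ?thesis by (auto simp: corner_trace_monom kac_cocycle_lmonom)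
      next
        case kl: True
        show ?thesis
        proof (cases "k \<le> int m")
          case True
          then show ?thesis using M kl by (simp add: corner_trace_monom_eq_kac_cocycle)
        next
          case False
          then have "l + k = int n + int m" "l \<le> int n" "int M \<ge> int n - l" using M kl by auto
          from corner_trace_monom_eq_kac_cocycle[OF this] show ?thesis
            by (simp add: kac_cocycle_monom_swap[of "lmonom d l"])
        qed
      qed
    qed
  next
    case (add B B')
    then show ?case
      by eventually_elim (simp only: corner_trace_add_left corner_trace_add_right
          kac_cocycle_add_right add_diff_add minus_add_distrib)
  qed simp
next
  case (add A A')
  then show ?case
    by eventually_elim (simp only: corner_trace_add_left corner_trace_add_right
        kac_cocycle_add_left add_diff_add minus_add_distrib)
qed simp

theorem proposition5p14:
  fixes A B :: "laurent diffop"
  shows "circle_cocycle A B = - kac_cocycle A B"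
proof -
  have "\<forall>\<^sub>F M in sequentially. circle_cocycle A B = - kac_cocycle A B"
    using circle_cocycle_eq_corner_trace[of A B] corner_trace_commutator_eq_kac_cocycle[of A B]
    by eventually_elim simp
  then show ?thesis by simp
qed

end
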